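(* Let $d\ge4$. Let $(V,\mathcal{B})$ be a $d$-partite hypergraph with a given $d$-partition $V_1,\ldots,V_d$, let $c\in\mathbb{R}_{\ge0}^V$ be vertex costs, let $n=|V|$, and let $x$ be a fractional vertex cover. There is a randomized linear-time algorithm that computes an integral solution $\bar x\in\{0,1\}^V$ (a vertex cover) of expected cost $\mathbb{E}[\sum_{v\in V}c_v\bar x_v]\le\left(\frac d2-\frac{d}{64n}\right)\sum_{v\in V}c_vx_v$.
   Context: A hypergraph $(V,\mathcal{B})$ is $d$-partite if there is a partition $V=V_1\dot\cup\cdots\dot\cup V_d$ (a $d$-partition) with $|P\cap V_i|\le1$ for all $P\in\mathcal{B}$ and all $i$; the hypergraph need not be uniform. A fractional vertex cover is a vector $x\in\mathbb{R}_{\ge0}^V$ with $\sum_{v\in P}x_v\ge1$ for all $P\in\mathcal{B}$; an integral solution is $\bar x\in\{0,1\}^V$ with $\sum_{v\in P}\bar x_v\ge1$ for all $P\in\mathcal{B}$. The algorithm receives $V$, the $d$-partition, $c$ and $x$. *)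

theory Defs
  imports "HOL-Probability.Probability"
begin

section \<open>Partite hypergraphs and vertex covers\<close>

definition hypergraph :: "'a set \<Rightarrow> 'a set set \<Rightarrow> bool" where
  "hypergraph V B \<longleftrightarrow> finite V \<and> B \<subseteq> Pow V"

text \<open>Parts may be empty; this only enlarges the class of admissible partitions.\<close>

definition d_partition :: "nat \<Rightarrow> 'a set \<Rightarrow> 'a set set \<Rightarrow> (nat \<Rightarrow> 'a set) \<Rightarrow> bool" where
  "d_partition d V B Vs \<longleftrightarrow>
     (\<Union>i\<in>{1..d}. Vs i) = V \<and> disjoint_family_on Vs {1..d} \<and>
     (\<forall>P\<in>B. \<forall>i\<in>{1..d}. card (P \<inter> Vs i) \<le> 1)"

definition fractional_vertex_cover :: "'a set \<Rightarrow> 'a set set \<Rightarrow> ('a \<Rightarrow> real) \<Rightarrow> bool" where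
  "fractional_vertex_cover V B x \<longleftrightarrow>
     (\<forall>v\<in>V. x v \<ge> 0) \<and> (\<forall>P\<in>B. (\<Sum>v\<in>P. x v) \<ge> 1)"

definition integral_vertex_cover :: "'a set \<Rightarrow> 'a set set \<Rightarrow> ('a \<Rightarrow> real) \<Rightarrow> bool" where
  "integral_vertex_cover V B y \<longleftrightarrow>
     (\<forall>v\<in>V. y v \<in> {0, 1}) \<and> (\<forall>P\<in>B. (\<Sum>v\<in>P. y v) \<ge> 1)"


section \<open>A randomized real RAM\<close>

text \<open>
  The machine is a structured real RAM with natural-number and real variables and arrays.
  Reals can be added, subtracted, multiplied, divided (with \<open>a / 0 = 0\<close>) and compared;
  there is no rounding operation, and only rational constants occur in programs.
  Naturals, which serve as array indices, can be added, subtracted (truncated at 0) and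
  compared; without multiplication their bit length grows by at most a constant per step.
\<close>

datatype nexp =
    NConst nat
  | NVar string
  | NArr string nexp
  | NAdd nexp nexp
  | NSub nexp nexp

datatype rexp =
    RConst rat
  | RVar string
  | RArr string nexp
  | ROfNat nexp
  | RAdd rexp rexp
  | RSub rexp rexp
  | RMul rexp rexp
  | RDiv rexp rexp

datatype bexp =
    NLess nexp nexp
  | RLess rexp rexp
  | BNot bexp
  | BAnd bexp bexp

datatype com =
    Skip
  | NAssign string nexp
  | RAssign string rexp
  | NArrAssign string nexp nexp
  | RArrAssign string nexp rexp
  | Draw string
  | Seq com com
  | Cond bexp com com
  | While bexp com

text \<open>The field \<open>draws\<close> counts the random numbers consumed so far.\<close>

record mem =
  nvar :: "string \<Rightarrow> nat"
  rvar :: "string \<Rightarrow> real"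
  narr :: "string \<Rightarrow> nat \<Rightarrow> nat"
  rarr :: "string \<Rightarrow> nat \<Rightarrow> real"
  draws :: nat

primrec nval :: "nexp \<Rightarrow> mem \<Rightarrow> nat" where
  "nval (NConst k) s = k"
| "nval (NVar a) s = nvar s a"
| "nval (NArr a i) s = narr s a (nval i s)"
| "nval (NAdd p q) s = nval p s + nval q s"
| "nval (NSub p q) s = nval p s - nval q s"

primrec rval :: "rexp \<Rightarrow> mem \<Rightarrow> real" where
  "rval (RConst q) s = of_rat q"
| "rval (RVar a) s = rvar s a"
| "rval (RArr a i) s = rarr s a (nval i s)"
| "rval (ROfNat p) s = real (nval p s)"
| "rval (RAdd p q) s = rval p s + rval q s"
| "rval (RSub p q) s = rval p s - rval q s"
| "rval (RMul p q) s = rval p s * rval q s"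
| "rval (RDiv p q) s = rval p s / rval q s"

primrec bval :: "bexp \<Rightarrow> mem \<Rightarrow> bool" where
  "bval (NLess p q) s \<longleftrightarrow> nval p s < nval q s"
| "bval (RLess p q) s \<longleftrightarrow> rval p s < rval q s"
| "bval (BNot b) s \<longleftrightarrow> \<not> bval b s"
| "bval (BAnd a b) s \<longleftrightarrow> bval a s \<and> bval b s"

text \<open>
  \<open>exec \<omega> p s t s'\<close>: with random tape \<open>\<omega>\<close>, program \<open>p\<close> started in \<open>s\<close> halts in \<open>s'\<close> after
  \<open>t\<close> steps. Each assignment, random draw and evaluation of a test is one step: the
  expressions in a program have a size independent of the input, so charging for every
  arithmetic operation would change \<open>t\<close> by at most a constant factor for each program.
\<close>

inductive exec :: "(nat \<Rightarrow> real) \<Rightarrow> com \<Rightarrow> mem \<Rightarrow> nat \<Rightarrow> mem \<Rightarrow> bool" for \<omega> where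
  Skip: "exec \<omega> Skip s 1 s"
| NAssign: "exec \<omega> (NAssign a p) s 1 (s\<lparr>nvar := (nvar s)(a := nval p s)\<rparr>)"
| RAssign: "exec \<omega> (RAssign a p) s 1 (s\<lparr>rvar := (rvar s)(a := rval p s)\<rparr>)"
| NArrAssign: "exec \<omega> (NArrAssign a i p) s 1
    (s\<lparr>narr := (narr s)(a := (narr s a)(nval i s := nval p s))\<rparr>)"
| RArrAssign: "exec \<omega> (RArrAssign a i p) s 1
    (s\<lparr>rarr := (rarr s)(a := (rarr s a)(nval i s := rval p s))\<rparr>)"
| Draw: "exec \<omega> (Draw a) s 1
    (s\<lparr>rvar := (rvar s)(a := \<omega> (draws s)), draws := Suc (draws s)\<rparr>)"
| Seq: "exec \<omega> p s t s' \<Longrightarrow> exec \<omega> q s' u s'' \<Longrightarrow> exec \<omega> (Seq p q) s (t + u) s''"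
| CondTrue: "bval b s \<Longrightarrow> exec \<omega> p s t s' \<Longrightarrow> exec \<omega> (Cond b p q) s (Suc t) s'"
| CondFalse: "\<not> bval b s \<Longrightarrow> exec \<omega> q s t s' \<Longrightarrow> exec \<omega> (Cond b p q) s (Suc t) s'"
| WhileFalse: "\<not> bval b s \<Longrightarrow> exec \<omega> (While b p) s 1 s"
| WhileTrue: "bval b s \<Longrightarrow> exec \<omega> p s t s' \<Longrightarrow> exec \<omega> (While b p) s' u s'' \<Longrightarrow>
    exec \<omega> (While b p) s (Suc (t + u)) s''"

inductive_cases exec_SkipE: "exec \<omega> Skip s t s'"
inductive_cases exec_NAssignE: "exec \<omega> (NAssign a p) s t s'"
inductive_cases exec_RAssignE: "exec \<omega> (RAssign a p) s t s'"
inductive_cases exec_NArrAssignE: "exec \<omega> (NArrAssign a i p) s t s'"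
inductive_cases exec_RArrAssignE: "exec \<omega> (RArrAssign a i p) s t s'"
inductive_cases exec_DrawE: "exec \<omega> (Draw a) s t s'"
inductive_cases exec_SeqE: "exec \<omega> (Seq p q) s t s'"
inductive_cases exec_CondE: "exec \<omega> (Cond b p q) s t s'"
inductive_cases exec_WhileE: "exec \<omega> (While b p) s t s'"

lemma exec_deterministic:
  "exec \<omega> p s t s' \<Longrightarrow> exec \<omega> p s u s'' \<Longrightarrow> t = u \<and> s' = s''"
proof (induction arbitrary: u s'' rule: exec.induct)
  case Skip
  then show ?case by (rule exec_SkipE) simp
next
  case NAssign
  then show ?case by (rule exec_NAssignE) simp
next
  case RAssign
  then show ?case by (rule exec_RAssignE) simp
next
  case NArrAssign
  then show ?case by (rule exec_NArrAssignE) simp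
next
  case RArrAssign
  then show ?case by (rule exec_RArrAssignE) simp
next
  case Draw
  then show ?case by (rule exec_DrawE) simp
next
  case Seq
  from Seq.prems show ?case by (rule exec_SeqE) (metis Seq.IH)
next
  case CondTrue
  from CondTrue.prems show ?case by (rule exec_CondE) (use CondTrue in metis)+
next
  case CondFalse
  from CondFalse.prems show ?case by (rule exec_CondE) (use CondFalse in metis)+
next
  case WhileFalse
  from WhileFalse.prems show ?case by (rule exec_WhileE) (use WhileFalse in simp_all)
next
  case WhileTrue
  from WhileTrue.prems show ?case
    by (rule exec_WhileE) (use WhileTrue.hyps in simp, metis WhileTrue.IH)
qed

definition halts_within :: "nat \<Rightarrow> (nat \<Rightarrow> real) \<Rightarrow> com \<Rightarrow> mem \<Rightarrow> bool" where
  "halts_within T \<omega> p s \<longleftrightarrow> (\<exists>t s'. exec \<omega> p s t s' \<and> t \<le> T)"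

definition final_mem :: "(nat \<Rightarrow> real) \<Rightarrow> com \<Rightarrow> mem \<Rightarrow> mem" where
  "final_mem \<omega> p s = (THE s'. \<exists>t. exec \<omega> p s t s')"

text \<open>Independent random numbers, each uniformly distributed on the unit interval.\<close>

definition tape :: "(nat \<Rightarrow> real) measure" where
  "tape = Pi\<^sub>M UNIV (\<lambda>_. restrict_space lborel {0..1})"


section \<open>Input and output\<close>

text \<open>
  The vertices are presented in some order \<open>e 0, ..., e (card V - 1)\<close>. The input consists of
  the numbers \<open>n = card V\<close> and \<open>d\<close> and of three arrays of length \<open>n\<close> holding, for each
  vertex, the index of its part, its cost and its fractional value. The hyperedges are not
  part of the input.
\<close>

definition input_mem ::
    "nat \<Rightarrow> 'a set \<Rightarrow> (nat \<Rightarrow> 'a set) \<Rightarrow> ('a \<Rightarrow> real) \<Rightarrow> ('a \<Rightarrow> real) \<Rightarrow> (nat \<Rightarrow> 'a) \<Rightarrow> mem" where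
  "input_mem d V Vs c x e =
     \<lparr>nvar = (\<lambda>_. 0)(''n'' := card V, ''d'' := d),
      rvar = (\<lambda>_. 0),
      narr = (\<lambda>_ _. 0)(''part'' :=
        (\<lambda>k. if k < card V then THE i. i \<in> {1..d} \<and> e k \<in> Vs i else 0)),
      rarr = (\<lambda>_ _. 0)(''c'' := (\<lambda>k. if k < card V then c (e k) else 0),
                       ''x'' := (\<lambda>k. if k < card V then x (e k) else 0)),
      draws = 0\<rparr>"

definition output_vector :: "'a set \<Rightarrow> (nat \<Rightarrow> 'a) \<Rightarrow> mem \<Rightarrow> 'a \<Rightarrow> real" where
  "output_vector V e s v = real (narr s ''out'' (the_inv_into {..<card V} e v))"

definition computed_vector ::
    "com \<Rightarrow> nat \<Rightarrow> 'a set \<Rightarrow> (nat \<Rightarrow> 'a set) \<Rightarrow> ('a \<Rightarrow> real) \<Rightarrow> ('a \<Rightarrow> real) \<Rightarrow> (nat \<Rightarrow> 'a) \<Rightarrow>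
     (nat \<Rightarrow> real) \<Rightarrow> 'a \<Rightarrow> real" where
  "computed_vector p d V Vs c x e \<omega> =
     output_vector V e (final_mem \<omega> p (input_mem d V Vs c x e))"

end

theory Submission
  imports Defs
begin

text \<open>
  Following Lovasz, part \<open>p\<close> receives a random threshold \<open>2 / d * T\<^sub>p\<close>, where each
  \<open>T\<^sub>p\<close> is uniform on the unit interval and the \<open>T\<^sub>p\<close> always add up to \<open>d / 2\<close>; taking
  every vertex whose value reaches the threshold of its part yields a cover that contains
  \<open>v\<close> with probability at most \<open>d / 2 * x v\<close>.

  The gain comes from the gaps between the values of the vertices. Let \<open>heavy\<close> be the part
  of largest weight \<open>\<Sum> c v * x v\<close> and \<open>light\<close> the smallest other part, with \<open>m - 1\<close> vertices.
  In \<open>light\<close> the threshold can be lowered to the largest value \<open>a\<close> below it without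
  changing the selection, so the threshold of \<open>heavy\<close> can be raised by the same amount. As
  the two thresholds are independent and the gap exceeds \<open>1 / (2 * m)\<close> (in units of
  \<open>2 / d\<close>) with probability at least \<open>1 / 2\<close>, this saves a fraction \<open>1 / (8 * m)\<close> of the
  weight of \<open>heavy\<close>. If \<open>q\<close> parts are nonempty, \<open>heavy\<close> carries at least a fraction \<open>1 / q\<close>
  of the total weight, and \<open>q * m \<le> 4 * n\<close>.
\<close>

section \<open>Reasoning about programs\<close>

text \<open>Only loop-free programs have a useful \<open>wp\<close>; loops go through invariants.\<close>

primrec wp :: "(nat \<Rightarrow> real) \<Rightarrow> com \<Rightarrow> (mem \<Rightarrow> bool) \<Rightarrow> mem \<Rightarrow> bool" where
  "wp \<omega> Skip Q s \<longleftrightarrow> Q s"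
| "wp \<omega> (NAssign a p) Q s \<longleftrightarrow> Q (s\<lparr>nvar := (nvar s)(a := nval p s)\<rparr>)"
| "wp \<omega> (RAssign a p) Q s \<longleftrightarrow> Q (s\<lparr>rvar := (rvar s)(a := rval p s)\<rparr>)"
| "wp \<omega> (NArrAssign a i p) Q s \<longleftrightarrow>
     Q (s\<lparr>narr := (narr s)(a := (narr s a)(nval i s := nval p s))\<rparr>)"
| "wp \<omega> (RArrAssign a i p) Q s \<longleftrightarrow>
     Q (s\<lparr>rarr := (rarr s)(a := (rarr s a)(nval i s := rval p s))\<rparr>)"
| "wp \<omega> (Draw a) Q s \<longleftrightarrow>
     Q (s\<lparr>rvar := (rvar s)(a := \<omega> (draws s)), draws := Suc (draws s)\<rparr>)"
| "wp \<omega> (Seq p q) Q s \<longleftrightarrow> wp \<omega> p (wp \<omega> q Q) s"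
| "wp \<omega> (Cond b p q) Q s \<longleftrightarrow> (bval b s \<longrightarrow> wp \<omega> p Q s) \<and> (\<not> bval b s \<longrightarrow> wp \<omega> q Q s)"
| "wp \<omega> (While b p) Q s \<longleftrightarrow> False"

text \<open>Worst-case step count. The value for loops is a placeholder, harmless because
  \<open>wp\<close> of a loop is false.\<close>

primrec cost :: "com \<Rightarrow> nat" where
  "cost Skip = 1"
| "cost (NAssign a p) = 1"
| "cost (RAssign a p) = 1"
| "cost (NArrAssign a i p) = 1"
| "cost (RArrAssign a i p) = 1"
| "cost (Draw a) = 1"
| "cost (Seq p q) = cost p + cost q"
| "cost (Cond b p q) = Suc (max (cost p) (cost q))"
| "cost (While b p) = 0"

text \<open>Total correctness with a time bound; a single execution witnesses it because
  \<open>exec\<close> is deterministic.\<close>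

definition reaches :: "(nat \<Rightarrow> real) \<Rightarrow> com \<Rightarrow> mem \<Rightarrow> nat \<Rightarrow> (mem \<Rightarrow> bool) \<Rightarrow> bool" where
  "reaches \<omega> p s T Q \<longleftrightarrow> (\<exists>t s'. exec \<omega> p s t s' \<and> t \<le> T \<and> Q s')"

lemma reaches_atom: "exec \<omega> p s 1 s' \<Longrightarrow> Q s' \<Longrightarrow> reaches \<omega> p s (Suc 0) Q"
  by (auto simp: reaches_def)

lemma reaches_wp: "wp \<omega> p Q s \<Longrightarrow> reaches \<omega> p s (cost p) Q"
proof (induction p arbitrary: Q s)
  case (Seq p q)
  from Seq.IH(1)[of "wp \<omega> q Q" s] Seq.prems
  obtain t s' where 1: "exec \<omega> p s t s'" "t \<le> cost p" "wp \<omega> q Q s'"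
    by (auto simp: reaches_def)
  from Seq.IH(2)[OF 1(3)] obtain u s'' where "exec \<omega> q s' u s''" "u \<le> cost q" "Q s''"
    by (auto simp: reaches_def)
  with 1 show ?case
    unfolding reaches_def using exec.Seq[of \<omega> p s t s' q u s''] by fastforce
next
  case (Cond b p q)
  show ?case
  proof (cases "bval b s")
    case True
    with Cond obtain t s' where "exec \<omega> p s t s'" "t \<le> cost p" "Q s'"
      by (fastforce simp: reaches_def)
    with True show ?thesis
      unfolding reaches_def by (intro exI[of _ "Suc t"] exI[of _ s']) (auto intro: exec.CondTrue)
  next
    case False
    with Cond obtain t s' where "exec \<omega> q s t s'" "t \<le> cost q" "Q s'"
      by (fastforce simp: reaches_def)
    with False show ?thesis
      unfolding reaches_def by (intro exI[of _ "Suc t"] exI[of _ s']) (auto intro: exec.CondFalse)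
  qed
next
  case Skip
  then show ?case by (auto intro: reaches_atom exec.Skip)
next
  case (NAssign a p)
  then show ?case by (auto intro: reaches_atom exec.NAssign)
next
  case (RAssign a p)
  then show ?case by (auto intro: reaches_atom exec.RAssign)
next
  case (NArrAssign a i p)
  then show ?case by (auto intro: reaches_atom exec.NArrAssign)
next
  case (RArrAssign a i p)
  then show ?case by (auto intro: reaches_atom exec.RArrAssign)
next
  case (Draw a)
  then show ?case by (auto intro: reaches_atom exec.Draw)
qed simp

lemma reaches_Seq:
  assumes "reaches \<omega> p s T Q" and "\<And>s'. Q s' \<Longrightarrow> reaches \<omega> q s' U R"
  shows "reaches \<omega> (Seq p q) s (T + U) R"
  using assms unfolding reaches_def by (meson add_mono exec.Seq)

lemma reaches_le: "reaches \<omega> p s T Q \<Longrightarrow> T \<le> U \<Longrightarrow> reaches \<omega> p s U Q"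
  unfolding reaches_def by fastforce

definition triple :: "(nat \<Rightarrow> real) \<Rightarrow> (mem \<Rightarrow> bool) \<Rightarrow> com \<Rightarrow> nat \<Rightarrow> (mem \<Rightarrow> bool) \<Rightarrow> bool" where
  "triple \<omega> P p T Q \<longleftrightarrow> (\<forall>s. P s \<longrightarrow> reaches \<omega> p s T Q)"

lemma triple_Seq: "triple \<omega> P p T Q \<Longrightarrow> triple \<omega> Q q U R \<Longrightarrow> triple \<omega> P (Seq p q) (T + U) R"
  unfolding triple_def by (blast intro: reaches_Seq)

lemma triple_wp: "(\<And>s. P s \<Longrightarrow> wp \<omega> p Q s) \<Longrightarrow> triple \<omega> P p (cost p) Q"
  unfolding triple_def by (blast intro: reaches_wp)

lemma triple_le: "triple \<omega> P p T Q \<Longrightarrow> T \<le> U \<Longrightarrow> triple \<omega> P p U Q"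
  unfolding triple_def by (blast intro: reaches_le)

text \<open>Induction on the rounds left: each costs one successful test plus at most
  \<open>cost p\<close>, and the outer \<open>Suc\<close> pays for the failing test.\<close>

lemma reaches_While:
  assumes body: "\<And>m s. m < N \<Longrightarrow> J m s \<Longrightarrow> bval b s \<and> wp \<omega> p (J (Suc m)) s"
    and exit: "\<And>s. J N s \<Longrightarrow> \<not> bval b s"
    and "J m s" "m \<le> N"
  shows "reaches \<omega> (While b p) s (Suc ((N - m) * Suc (cost p))) (J N)"
  using assms(3,4)
proof (induction "N - m" arbitrary: m s)
  case 0
  then have "m = N" by simp
  then show ?case
    using 0 exit[of s] exec.WhileFalse[of b s \<omega> p] unfolding reaches_def by auto
next
  case (Suc k)
  then have "m < N" by simp
  from body[OF this Suc.prems(1)] have b: "bval b s" and "wp \<omega> p (J (Suc m)) s" by auto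
  from reaches_wp[OF this(2)]
  obtain t s' where t: "exec \<omega> p s t s'" "t \<le> cost p" "J (Suc m) s'"
    by (auto simp: reaches_def)
  have "k = N - Suc m" "Suc m \<le> N" using Suc by auto
  from Suc.hyps(1)[OF this(1) t(3) this(2)]
  obtain u s'' where u: "exec \<omega> (While b p) s' u s''"
      "u \<le> Suc ((N - Suc m) * Suc (cost p))" "J N s''"
    by (auto simp: reaches_def)
  have "Suc (t + u) \<le> Suc ((N - m) * Suc (cost p))"
    using t(2) u(2) \<open>m < N\<close> by (auto simp: Suc_diff_Suc[symmetric])
  with exec.WhileTrue[OF b t(1) u(1)] u(3) show ?case
    unfolding reaches_def by blast
qed

definition for_com :: "string \<Rightarrow> com \<Rightarrow> com" where
  "for_com b p = Seq (NAssign ''k'' (NConst 0))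
     (While (NLess (NVar ''k'') (NVar b))
       (Seq p (NAssign ''k'' (NAdd (NVar ''k'') (NConst 1)))))"

lemma wp_mono: "wp \<omega> p Q s \<Longrightarrow> (\<And>s. Q s \<Longrightarrow> R s) \<Longrightarrow> wp \<omega> p R s"
  by (induction p arbitrary: Q R s) (simp_all, (blast | fast)+)

text \<open>An invariant that ignores \<open>''k''\<close> survives initialisation and increment of
  the counter. Each round pays 2 extra steps for test and increment; the outer 2 pays for the
  initialisation and the last test.\<close>

lemma reaches_for:
  assumes "b \<noteq> ''k''" and "\<And>m s k. J m (s\<lparr>nvar := (nvar s)(''k'' := k)\<rparr>) = J m s"
    and "\<And>m s. m < N \<Longrightarrow> J m s \<Longrightarrow> nvar s b = N \<Longrightarrow> nvar s ''k'' = m \<Longrightarrow>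
           wp \<omega> p (\<lambda>s'. J (Suc m) s' \<and> nvar s' b = N \<and> nvar s' ''k'' = m) s"
    and "J 0 s" and "nvar s b = N"
  shows "reaches \<omega> (for_com b p) s (2 + N * (2 + cost p)) (J N)"
proof -
  define J' where "J' m s \<longleftrightarrow> J m s \<and> nvar s b = N \<and> nvar s ''k'' = m" for m s
  let ?c = "Seq p (NAssign ''k'' (NAdd (NVar ''k'') (NConst 1)))"
  let ?s = "s\<lparr>nvar := (nvar s)(''k'' := 0)\<rparr>"
  have "reaches \<omega> (While (NLess (NVar ''k'') (NVar b)) ?c) ?s (Suc ((N - 0) * Suc (cost ?c))) (J' N)"
  proof (rule reaches_While)
    fix m s assume "m < N" "J' m s"
    then have *: "wp \<omega> p (\<lambda>s'. J (Suc m) s' \<and> nvar s' b = N \<and> nvar s' ''k'' = m) s"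
      using assms(3) by (auto simp: J'_def)
    show "bval (NLess (NVar ''k'') (NVar b)) s \<and> wp \<omega> ?c (J' (Suc m)) s"
      using \<open>m < N\<close> \<open>J' m s\<close> assms(1,2) by (auto simp: J'_def intro!: wp_mono[OF *])
  qed (use assms in \<open>auto simp: J'_def\<close>)
  then obtain t s' where t: "exec \<omega> (While (NLess (NVar ''k'') (NVar b)) ?c) ?s t s'"
      "t \<le> Suc (N * Suc (cost ?c))" "J' N s'"
    by (auto simp: reaches_def)
  have "exec \<omega> (for_com b p) s (1 + t) s'"
    unfolding for_com_def using exec.Seq[OF exec.NAssign[of \<omega> "''k''" "NConst 0" s]] t(1) by simp
  moreover have "1 + t \<le> 2 + N * (2 + cost p)"
    using t(2) by simp
  ultimately show ?thesis
    using t(3) unfolding reaches_def J'_def by blast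
qed

abbreviation NEq :: "nexp \<Rightarrow> nexp \<Rightarrow> bexp" where
  "NEq p q \<equiv> BAnd (BNot (NLess p q)) (BNot (NLess q p))"

lemma wp_Cond_NEq:
  "wp \<omega> (Cond (NEq a b) p q) Q s \<longleftrightarrow> (if nval a s = nval b s then wp \<omega> p Q s else wp \<omega> q Q s)"
  by auto

section \<open>The rounding program\<close>

text \<open>
  Variables: \<open>j\<close> and \<open>i\<close> are the parts \<open>heavy\<close> and \<open>light\<close>, \<open>u\<close> and \<open>w\<close> their random
  numbers and \<open>a\<close> the largest value below the threshold of \<open>light\<close>; \<open>b\<close> is the parity of
  \<open>d\<close>. Arrays: \<open>w\<close> holds the weight and \<open>l\<close> the negated size of each part, \<open>r\<close> the
  levels of the other parts, \<open>t\<close> the thresholds. Parts are numbered from 1, hence \<open>k_succ\<close>.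
\<close>

abbreviation k_succ :: nexp where "k_succ \<equiv> NAdd (NVar ''k'') (NConst 1)"

definition weigh_com :: com where
  "weigh_com =
     Seq (RArrAssign ''w'' (NArr ''part'' (NVar ''k''))
            (RAdd (RArr ''w'' (NArr ''part'' (NVar ''k'')))
                  (RMul (RArr ''c'' (NVar ''k'')) (RArr ''x'' (NVar ''k'')))))
         (RArrAssign ''l'' (NArr ''part'' (NVar ''k''))
            (RSub (RArr ''l'' (NArr ''part'' (NVar ''k''))) (RConst 1)))"

text \<open>The scan starts from index 0, which is no part; a low sentinel stored there lets a
  genuine part win.\<close>

definition argmax_com :: "string \<Rightarrow> string \<Rightarrow> com" where
  "argmax_com a r = for_com ''d''
     (Cond (RLess (RArr a (NVar r)) (RArr a k_succ)) (NAssign r k_succ) Skip)"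

definition draw_com :: com where
  "draw_com =
     Seq (Draw ''u'') (Seq (Draw ''w'')
      (Seq (RArrAssign ''r'' (NConst 0) (RSub (RConst 1) (RVar ''w'')))
       (Cond (NLess (NVar ''b'') (NConst 1))
         (Seq (RArrAssign ''r'' (NConst 1) (RSub (RConst 1) (RVar ''u'')))
          (Seq (RArrAssign ''r'' (NConst 2) (RVar ''u''))
               (RArrAssign ''r'' (NConst 3) (RSub (RConst 1) (RVar ''u'')))))
         (Seq (Cond (RLess (RVar ''u'') (RConst (1 / 2)))
                (Seq (RArrAssign ''r'' (NConst 1) (RAdd (RVar ''u'') (RConst (1 / 2))))
                     (RArrAssign ''r'' (NConst 2)
                        (RSub (RConst 1) (RMul (RConst 2) (RVar ''u'')))))
                (Seq (RArrAssign ''r'' (NConst 1) (RSub (RVar ''u'') (RConst (1 / 2))))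
                     (RArrAssign ''r'' (NConst 2)
                        (RSub (RConst 2) (RMul (RConst 2) (RVar ''u''))))))
              (RArrAssign ''r'' (NConst 3) (RVar ''u''))))))"

text \<open>\<open>q\<close> counts the parts met so far other than \<open>j\<close> and
  \<open>i\<close>. Each of them consumes entry \<open>q\<close> of \<open>r\<close> and appends
  entry \<open>q + 4\<close> as the complement of entry \<open>q + 3\<close>, so the levels are
  generated with constant work per part.\<close>

definition threshold_com :: com where
  "threshold_com =
     (let scaled = (\<lambda>p. RMul (RDiv (RConst 2) (ROfNat (NVar ''d''))) p)
      in Cond (NEq k_succ (NVar ''j'')) (RArrAssign ''t'' k_succ (scaled (RVar ''u'')))
          (Cond (NEq k_succ (NVar ''i'')) (RArrAssign ''t'' k_succ (scaled (RVar ''w'')))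
            (Seq (RArrAssign ''t'' k_succ (scaled (RArr ''r'' (NVar ''q''))))
             (Seq (RArrAssign ''r'' (NAdd (NVar ''q'') (NConst 4))
                     (RSub (RConst 1) (RArr ''r'' (NAdd (NVar ''q'') (NConst 3)))))
                  (NAssign ''q'' (NAdd (NVar ''q'') (NConst 1)))))))"

definition below_com :: com where
  "below_com =
     Cond (NEq (NArr ''part'' (NVar ''k'')) (NVar ''i''))
       (Cond (BAnd (RLess (RArr ''x'' (NVar ''k'')) (RArr ''t'' (NVar ''i'')))
                   (RLess (RVar ''a'') (RArr ''x'' (NVar ''k''))))
         (RAssign ''a'' (RArr ''x'' (NVar ''k''))) Skip) Skip"

definition output_com :: com where
  "output_com =
     Cond (RLess (RArr ''x'' (NVar ''k'')) (RArr ''t'' (NArr ''part'' (NVar ''k'')))) Skip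
       (NArrAssign ''out'' (NVar ''k'') (NConst 1))"

text \<open>The machine has no parity test, so \<open>b\<close> is flipped \<open>d\<close> times.
  The last update touches only \<open>heavy\<close>: no value in \<open>light\<close> lies strictly
  between \<open>a\<close> and the threshold there, so the slack can be given away while the stored
  threshold of \<open>light\<close> stays.\<close>

definition rounding_com :: com where
  "rounding_com =
     Seq (for_com ''n'' weigh_com)
    (Seq (Seq (RArrAssign ''w'' (NConst 0) (RConst (- 1)))
              (RArrAssign ''l'' (NConst 0) (RSub (RConst (- 1)) (ROfNat (NVar ''n'')))))
    (Seq (argmax_com ''w'' ''j'')
    (Seq (RArrAssign ''l'' (NVar ''j'') (RSub (RConst (- 2)) (ROfNat (NVar ''n''))))
    (Seq (argmax_com ''l'' ''i'')
    (Seq (for_com ''d'' (NAssign ''b'' (NSub (NConst 1) (NVar ''b''))))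
    (Seq draw_com
    (Seq (for_com ''d'' threshold_com)
    (Seq (for_com ''n'' below_com)
    (Seq (RArrAssign ''t'' (NVar ''j'')
            (RSub (RAdd (RArr ''t'' (NVar ''j'')) (RArr ''t'' (NVar ''i''))) (RVar ''a'')))
         (for_com ''n'' output_com))))))))))"

section \<open>Mathematical counterparts of the computed quantities\<close>

primrec argmax_upto :: "(nat \<Rightarrow> real) \<Rightarrow> nat \<Rightarrow> nat" where
  "argmax_upto f 0 = 0"
| "argmax_upto f (Suc k) = (if f (argmax_upto f k) < f (Suc k) then Suc k else argmax_upto f k)"

lemma argmax_upto_ge: "l \<le> k \<Longrightarrow> f l \<le> f (argmax_upto f k)"
  by (induction k) (auto simp: le_Suc_eq)

lemma argmax_upto_le: "argmax_upto f k \<le> k"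
  by (induction k) auto

text \<open>
  For \<open>u\<close> uniform on the unit interval, \<open>u\<close>, \<open>rot_half u\<close> and \<open>fold_back u\<close> are all
  uniform and add up to \<open>3 / 2\<close>. This triple handles odd \<open>d\<close>; otherwise the levels are
  paired as \<open>u\<close> and \<open>1 - u\<close>.
\<close>

definition rot_half :: "real \<Rightarrow> real" where
  "rot_half u = (if u < 1 / 2 then u + 1 / 2 else u - 1 / 2)"

definition fold_back :: "real \<Rightarrow> real" where
  "fold_back u = (if u < 1 / 2 then 1 - 2 * u else 2 - 2 * u)"

text \<open>Entry 0 balances the level \<open>w\<close> of \<open>light\<close>. Entry 1 balances
  the level \<open>u\<close> of \<open>heavy\<close> for even \<open>d\<close>; for odd
  \<open>d\<close>, entries 1 and 2 complete its triple. The remaining entries alternate between a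
  value and its complement.\<close>

fun filler :: "bool \<Rightarrow> real \<Rightarrow> real \<Rightarrow> nat \<Rightarrow> real" where
  "filler b u w 0 = 1 - w"
| "filler b u w (Suc 0) = (if b then rot_half u else 1 - u)"
| "filler b u w (Suc (Suc 0)) = (if b then fold_back u else u)"
| "filler b u w (Suc (Suc (Suc 0))) = (if b then u else 1 - u)"
| "filler b u w (Suc (Suc (Suc (Suc q)))) = 1 - filler b u w (Suc (Suc (Suc q)))"

lemma less_4_cases: "m < 4 \<longleftrightarrow> m = 0 \<or> m = 1 \<or> m = 2 \<or> m = (3 :: nat)"
  by linarith

lemma filler_less_4:
  "filler b u w 0 = 1 - w"
  "filler b u w 1 = (if b then rot_half u else 1 - u)"
  "filler b u w 2 = (if b then fold_back u else u)"
  "filler b u w 3 = (if b then u else 1 - u)"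
  by (simp_all add: numeral_eq_Suc)

lemma filler_add_4: "filler b u w (q + 4) = 1 - filler b u w (q + 3)"
  by (simp add: numeral_eq_Suc)

text \<open>
  The \<open>q\<close>-th part other than the parts \<open>j\<close> (at level \<open>u\<close>) and \<open>i\<close> (at level \<open>w\<close>)
  receives \<open>filler b u w q\<close>; the boolean says whether \<open>d\<close> is odd.
\<close>

primrec slot :: "nat \<Rightarrow> nat \<Rightarrow> nat \<Rightarrow> nat" where
  "slot i j 0 = 0"
| "slot i j (Suc k) = (if Suc k = i \<or> Suc k = j then slot i j k else Suc (slot i j k))"

definition level :: "bool \<Rightarrow> nat \<Rightarrow> nat \<Rightarrow> real \<Rightarrow> real \<Rightarrow> nat \<Rightarrow> real" where
  "level b i j u w p =
     (if p = j then u else if p = i then w else filler b u w (slot i j (p - 1)))"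

locale rounding =
  fixes n d :: nat and part :: "nat \<Rightarrow> nat" and c x :: "nat \<Rightarrow> real"
begin

definition weight :: "nat \<Rightarrow> real" where
  "weight p = (\<Sum>k<n. if part k = p then c k * x k else 0)"

definition size_of :: "nat \<Rightarrow> real" where
  "size_of p = (\<Sum>k<n. if part k = p then 1 else 0)"

text \<open>
  Index 0 is not a part: its entry is a sentinel below all others. In the definition of
  \<open>light\<close>, so is the entry of \<open>heavy\<close>, which is thereby excluded.
\<close>

definition heavy :: nat where
  "heavy = argmax_upto (weight(0 := - 1)) d"

definition light :: nat where
  "light = argmax_upto ((\<lambda>p. - size_of p)(0 := - 1 - real n, heavy := - 2 - real n)) d"

definition threshold :: "real \<Rightarrow> real \<Rightarrow> nat \<Rightarrow> real" where
  "threshold u w p = 2 / real d * level (odd d) light heavy u w p"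

text \<open>The element 0 stands for hyperedges without a vertex in \<open>light\<close> and is the
  initial value of the program variable \<open>a\<close>. The bound \<open>m\<close> serves the loop
  invariant.\<close>

definition below :: "nat \<Rightarrow> real \<Rightarrow> real set" where
  "below m w = insert 0 {x k | k. k < m \<and> part k = light \<and> x k < 2 / real d * w}"

text \<open>Quantifying over \<open>below\<close> amounts to using its maximum \<open>a\<close>. The
  existential form lets the feasibility proof pick any element of \<open>below\<close>, and as a
  finite disjunction it is visibly measurable.\<close>

definition chosen :: "real \<Rightarrow> real \<Rightarrow> nat \<Rightarrow> bool" where
  "chosen u w k \<longleftrightarrow>
     (if part k = heavy
      then \<exists>z\<in>below n w. threshold u w heavy + threshold u w light \<le> x k + z
      else threshold u w (part k) \<le> x k)"

definition loaded :: "mem \<Rightarrow> bool" where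
  "loaded s \<longleftrightarrow> nvar s ''n'' = n \<and> nvar s ''d'' = d \<and> narr s ''part'' = part \<and>
     rarr s ''c'' = c \<and> rarr s ''x'' = x \<and> narr s ''out'' = (\<lambda>_. 0)"

section \<open>Loop invariants of the rounding program\<close>

lemma reaches_weigh:
  assumes "loaded s" "nvar s ''b'' = 0" "rvar s ''a'' = 0" "nvar s ''q'' = 0" "draws s = 0"
    "nvar s ''i'' = 0" "nvar s ''j'' = 0" "\<forall>p. rarr s ''w'' p = 0 \<and> rarr s ''l'' p = 0"
  shows "reaches \<omega> (for_com ''n'' weigh_com) s (2 + n * (2 + cost weigh_com))
     (\<lambda>s. loaded s \<and> nvar s ''b'' = 0 \<and> rvar s ''a'' = 0 \<and> nvar s ''q'' = 0 \<and> draws s = 0 \<and>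
       nvar s ''i'' = 0 \<and> nvar s ''j'' = 0 \<and>
       (\<forall>p. rarr s ''w'' p = weight p) \<and> (\<forall>p. rarr s ''l'' p = - size_of p))"
  unfolding weight_def size_of_def
  by (rule reaches_for[where J = "\<lambda>m s. loaded s \<and> nvar s ''b'' = 0 \<and> rvar s ''a'' = 0 \<and>
       nvar s ''q'' = 0 \<and> draws s = 0 \<and> nvar s ''i'' = 0 \<and> nvar s ''j'' = 0 \<and>
       (\<forall>p. rarr s ''w'' p = (\<Sum>k<m. if part k = p then c k * x k else 0)) \<and>
       (\<forall>p. rarr s ''l'' p = - (\<Sum>k<m. if part k = p then 1 else 0))"])
     (use assms in \<open>simp_all add: loaded_def weigh_com_def\<close>)

lemma reaches_argmax:
  assumes "r \<noteq> ''k''" "r \<noteq> ''d''" "\<And>s k. P (s\<lparr>nvar := (nvar s)(''k'' := k)\<rparr>) = P s"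
    "\<And>s k. P (s\<lparr>nvar := (nvar s)(r := k)\<rparr>) = P s"
    "P s" "nvar s r = 0" "nvar s ''d'' = d" "rarr s a = f"
  shows "reaches \<omega> (argmax_com a r) s (2 + d * 4)
     (\<lambda>s. P s \<and> nvar s r = argmax_upto f d)"
proof -
  let ?p = "Cond (RLess (RArr a (NVar r)) (RArr a k_succ)) (NAssign r k_succ) Skip"
  have "reaches \<omega> (argmax_com a r) s (2 + d * (2 + cost ?p))
     (\<lambda>s. P s \<and> nvar s r = argmax_upto f d \<and> rarr s a = f)"
    unfolding argmax_com_def
    by (rule reaches_for[where J = "\<lambda>m s. P s \<and> nvar s r = argmax_upto f m \<and> rarr s a = f"])
       (use assms in simp_all)
  then show ?thesis unfolding reaches_def by fastforce
qed

lemma reaches_parity: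
  assumes "\<And>s a k. a = ''k'' \<or> a = ''b'' \<Longrightarrow> P (s\<lparr>nvar := (nvar s)(a := k)\<rparr>) = P s"
    "P s" "nvar s ''b'' = 0" "nvar s ''d'' = d"
  shows "reaches \<omega> (for_com ''d'' (NAssign ''b'' (NSub (NConst 1) (NVar ''b'')))) s (2 + d * 3)
     (\<lambda>s. P s \<and> nvar s ''b'' = of_bool (odd d))"
proof -
  have "reaches \<omega> (for_com ''d'' (NAssign ''b'' (NSub (NConst 1) (NVar ''b'')))) s
      (2 + d * (2 + cost (NAssign ''b'' (NSub (NConst 1) (NVar ''b'')))))
     (\<lambda>s. P s \<and> nvar s ''b'' = of_bool (odd d))"
    by (rule reaches_for[where J = "\<lambda>m s. P s \<and> nvar s ''b'' = of_bool (odd m)"])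
       (use assms in \<open>simp_all\<close>)
  then show ?thesis by simp
qed

text \<open>The array runs four entries ahead of the \<open>q\<close> already consumed: the first
  entries are irregular, and entry 3 starts the chain of complements.\<close>

definition filled :: "real \<Rightarrow> real \<Rightarrow> nat \<Rightarrow> (nat \<Rightarrow> real) \<Rightarrow> bool" where
  "filled u w q r \<longleftrightarrow> (\<forall>l<q + 4. r l = filler (odd d) u w l)"

definition assigned :: "real \<Rightarrow> real \<Rightarrow> nat \<Rightarrow> (nat \<Rightarrow> real) \<Rightarrow> bool" where
  "assigned u w m t \<longleftrightarrow> (\<forall>p\<in>{1..m}. t p = threshold u w p)"

lemma wp_draw:
  assumes "loaded s" "nvar s ''b'' = of_bool (odd d)" "rvar s ''a'' = 0" "nvar s ''q'' = 0"
    "draws s = 0" "nvar s ''i'' = light" "nvar s ''j'' = heavy"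
  shows "wp \<omega> draw_com (\<lambda>s. loaded s \<and> rvar s ''a'' = 0 \<and> nvar s ''q'' = 0 \<and>
      nvar s ''i'' = light \<and> nvar s ''j'' = heavy \<and>
      rvar s ''u'' = \<omega> 0 \<and> rvar s ''w'' = \<omega> 1 \<and>
      filled (\<omega> 0) (\<omega> 1) 0 (rarr s ''r'')) s"
  using assms unfolding draw_com_def filled_def add_0 less_4_cases
  by (cases "odd d")
     (simp_all add: loaded_def all_conj_distrib disj_imp filler_less_4 rot_half_def fold_back_def
       of_rat_divide)

lemma filled_step:
  assumes "filled u w q r"
  shows "filled u w (Suc q) (r(q + 4 := 1 - filler (odd d) u w (q + 3)))"
  unfolding filled_def
proof (intro allI impI)
  fix l assume "l < Suc q + 4"
  then consider "l < q + 4" | "l = q + 4" by linarith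
  then show "(r(q + 4 := 1 - filler (odd d) u w (q + 3))) l = filler (odd d) u w l"
  proof cases
    case 1
    then show ?thesis using assms by (auto simp: filled_def)
  next
    case 2
    show ?thesis unfolding 2 filler_add_4 by simp
  qed
qed

lemma assigned_step: "assigned u w m t \<Longrightarrow> assigned u w (Suc m) (t(Suc m := threshold u w (Suc m)))"
  by (auto simp: assigned_def le_Suc_eq)

lemma wp_threshold_special:
  assumes "Suc m = heavy \<or> Suc m = light"
    and s: "nvar s ''i'' = light" "nvar s ''j'' = heavy" "nvar s ''d'' = d" "nvar s ''k'' = m"
      "rvar s ''u'' = u" "rvar s ''w'' = w"
  shows "wp \<omega> threshold_com Q s \<longleftrightarrow> Q (s\<lparr>
          rarr := (rarr s)(''t'' := (rarr s ''t'')(Suc m := threshold u w (Suc m)))\<rparr>)"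
  unfolding threshold_com_def Let_def wp_Cond_NEq using s
  by (simp add: threshold_def level_def) (use assms(1) in blast)

lemma wp_threshold_filler:
  assumes "Suc m \<noteq> heavy" "Suc m \<noteq> light" "filled u w (slot light heavy m) (rarr s ''r'')"
    and s: "nvar s ''i'' = light" "nvar s ''j'' = heavy" "nvar s ''d'' = d" "nvar s ''k'' = m"
      "rvar s ''u'' = u" "rvar s ''w'' = w" "nvar s ''q'' = q" "slot light heavy m = q"
  shows "wp \<omega> threshold_com Q s \<longleftrightarrow> Q (s\<lparr>
          rarr := (rarr s)(''t'' := (rarr s ''t'')(Suc m := threshold u w (Suc m)),
            ''r'' := (rarr s ''r'')(q + 4 := 1 - filler (odd d) u w (q + 3))),
          nvar := (nvar s)(''q'' := Suc q)\<rparr>)"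
proof -
  have "rarr s ''r'' q = filler (odd d) u w q" "rarr s ''r'' (q + 3) = filler (odd d) u w (q + 3)"
    using assms(3) s(8) by (auto simp: filled_def)
  moreover have "threshold u w (Suc m) = 2 / real d * filler (odd d) u w q"
    using assms(1,2) s(8) by (simp add: threshold_def level_def)
  ultimately show ?thesis
    unfolding threshold_com_def Let_def wp_Cond_NEq using s assms(1,2) by simp
qed

lemma reaches_threshold:
  assumes "loaded s" "rvar s ''a'' = 0" "nvar s ''q'' = 0"
    "nvar s ''i'' = light" "nvar s ''j'' = heavy" "rvar s ''u'' = u" "rvar s ''w'' = w"
    "filled u w 0 (rarr s ''r'')"
  shows "reaches \<omega> (for_com ''d'' threshold_com) s (2 + d * (2 + cost threshold_com))
     (\<lambda>s. loaded s \<and> rvar s ''a'' = 0 \<and> nvar s ''i'' = light \<and> nvar s ''j'' = heavy \<and>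
      assigned u w d (rarr s ''t''))"
proof -
  \<comment> \<open>\<open>slot light heavy m\<close> is the index that \<open>level\<close> uses
    for part \<open>Suc m\<close> when this part is neither \<open>heavy\<close> nor
    \<open>light\<close>; the variable \<open>q\<close> tracks it.\<close>
  let ?J = "\<lambda>m s. loaded s \<and> rvar s ''a'' = 0 \<and> nvar s ''i'' = light \<and> nvar s ''j'' = heavy \<and>
      rvar s ''u'' = u \<and> rvar s ''w'' = w \<and> nvar s ''q'' = slot light heavy m \<and>
      filled u w (slot light heavy m) (rarr s ''r'') \<and> assigned u w m (rarr s ''t'')"
  have "reaches \<omega> (for_com ''d'' threshold_com) s (2 + d * (2 + cost threshold_com)) (?J d)"
  proof (rule reaches_for[where J = ?J])
    fix m s assume *: "m < d" "?J m s" "nvar s ''d'' = d" "nvar s ''k'' = m"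
    show "wp \<omega> threshold_com (\<lambda>s'. ?J (Suc m) s' \<and> nvar s' ''d'' = d \<and> nvar s' ''k'' = m) s"
    proof (cases "Suc m = heavy \<or> Suc m = light")
      case True
      then have slot: "slot light heavy (Suc m) = slot light heavy m" by auto
      show ?thesis
        unfolding slot using * wp_threshold_special[OF True, of s u w \<omega>]
        by (simp add: loaded_def assigned_step)
    next
      case False
      define q where "q = slot light heavy m"
      have slot: "slot light heavy (Suc m) = Suc q" using False by (simp add: q_def)
      show ?thesis
        unfolding slot using * False wp_threshold_filler[of m u w s q \<omega>]
        by (simp add: loaded_def assigned_step filled_step flip: q_def)
    qed
  qed (use assms in \<open>simp_all add: loaded_def assigned_def\<close>)
  then show ?thesis unfolding reaches_def by fastforce
qed

lemma reaches_below:
  assumes "loaded s" "rvar s ''a'' = 0" "nvar s ''i'' = light" "nvar s ''j'' = heavy"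
    "assigned u w d (rarr s ''t'')" "rarr s ''t'' light = 2 / real d * w"
  shows "reaches \<omega> (for_com ''n'' below_com) s (2 + n * (2 + cost below_com))
     (\<lambda>s. loaded s \<and> nvar s ''i'' = light \<and> nvar s ''j'' = heavy \<and>
      assigned u w d (rarr s ''t'') \<and>
      rvar s ''a'' \<in> below n w \<and> (\<forall>z\<in>below n w. z \<le> rvar s ''a''))"
proof -
  let ?J = "\<lambda>m s. loaded s \<and> nvar s ''i'' = light \<and> nvar s ''j'' = heavy \<and>
      assigned u w d (rarr s ''t'') \<and> rarr s ''t'' light = 2 / real d * w \<and>
      rvar s ''a'' \<in> below m w \<and> (\<forall>z\<in>below m w. z \<le> rvar s ''a'')"
  have below_Suc: "below (Suc m) w = (if part m = light \<and> x m < 2 / real d * w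
      then insert (x m) (below m w) else below m w)" for m
    by (auto simp: below_def less_Suc_eq)
  have "reaches \<omega> (for_com ''n'' below_com) s (2 + n * (2 + cost below_com)) (?J n)"
  proof (rule reaches_for[where J = ?J])
    fix m s assume *: "m < n" "?J m s" "nvar s ''n'' = n" "nvar s ''k'' = m"
    have "rvar s ''a'' \<in> below m w" "\<forall>z\<in>below m w. z \<le> rvar s ''a''" using * by blast+
    \<comment> \<open>A value that replaces \<open>a\<close> exceeds it and hence everything seen
      before.\<close>
    moreover have "\<forall>z\<in>below m w. z \<le> x m" if "rvar s ''a'' < x m"
      using that calculation by force
    ultimately show "wp \<omega> below_com (\<lambda>s'. ?J (Suc m) s' \<and> nvar s' ''n'' = n \<and> nvar s' ''k'' = m) s"
      using * by (simp add: loaded_def below_com_def below_Suc not_less)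
  qed (use assms in \<open>simp_all add: loaded_def below_def\<close>)
  then show ?thesis unfolding reaches_def by fastforce
qed

lemma reaches_output:
  assumes "loaded s" "rarr s ''t'' = t"
  shows "reaches \<omega> (for_com ''n'' output_com) s (2 + n * (2 + cost output_com))
     (\<lambda>s. \<forall>k<n. narr s ''out'' k = of_bool (t (part k) \<le> x k))"
proof -
  let ?J = "\<lambda>m s. nvar s ''n'' = n \<and> narr s ''part'' = part \<and> rarr s ''x'' = x \<and>
     rarr s ''t'' = t \<and> (\<forall>k. narr s ''out'' k = of_bool (k < m \<and> t (part k) \<le> x k))"
  have "reaches \<omega> (for_com ''n'' output_com) s (2 + n * (2 + cost output_com)) (?J n)"
    by (rule reaches_for[where J = ?J])
       (use assms in \<open>auto simp add: loaded_def output_com_def less_Suc_eq not_less\<close>)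
  then show ?thesis unfolding reaches_def by fastforce
qed

end

locale rounding_instance = rounding +
  assumes d: "4 \<le> d"
    and part_range: "k < n \<Longrightarrow> part k \<in> {1..d}"
    and c_nonneg: "k < n \<Longrightarrow> 0 \<le> c k"
    and x_nonneg: "k < n \<Longrightarrow> 0 \<le> x k"
begin

lemma weight_nonneg: "0 \<le> weight p"
  unfolding weight_def using c_nonneg x_nonneg by (intro sum_nonneg) auto

lemma size_of_bounds: "0 \<le> size_of p" "size_of p \<le> real n"
proof -
  show "0 \<le> size_of p" unfolding size_of_def by (intro sum_nonneg) auto
  have "size_of p \<le> (\<Sum>k<n. 1)" unfolding size_of_def by (intro sum_mono) auto
  then show "size_of p \<le> real n" by simp
qed

lemma heavy_range: "heavy \<in> {1..d}"
proof -
  have "heavy \<noteq> 0"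
  proof
    assume "heavy = 0"
    with argmax_upto_ge[of 1 d "weight(0 := - 1)"] d weight_nonneg[of 1]
    show False by (simp add: heavy_def)
  qed
  then show ?thesis using argmax_upto_le[of "weight(0 := - 1)" d] by (simp add: heavy_def)
qed

lemma weight_le_heavy: "p \<in> {1..d} \<Longrightarrow> weight p \<le> weight heavy"
  using argmax_upto_ge[of p d "weight(0 := - 1)"] heavy_range by (auto simp flip: heavy_def)

text \<open>Sizes lie between 0 and \<open>n\<close>, so any part other than \<open>heavy\<close>
  beats both sentinels \<open>- 1 - n\<close> and \<open>- 2 - n\<close>; one such part forces the
  argmax to be a genuine part other than \<open>heavy\<close>.\<close>

lemma light_max:
  assumes "p \<in> {1..d}" "p \<noteq> heavy"
  shows "light \<in> {1..d}" "light \<noteq> heavy" "size_of light \<le> size_of p"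
proof -
  let ?f = "(\<lambda>p. - size_of p)(0 := - 1 - real n, heavy := - 2 - real n)"
  have "?f p \<le> ?f light"
    using argmax_upto_ge[of p d ?f] assms(1) by (simp add: light_def)
  moreover have "?f p = - size_of p" "- real n \<le> - size_of p"
    using assms size_of_bounds[of p] by auto
  ultimately have *: "- size_of p \<le> ?f light" "- real n \<le> ?f light" by linarith+
  then show "light \<noteq> heavy" by auto
  then have "light \<noteq> 0" using * by (auto simp: fun_upd_def split: if_splits)
  then show "light \<in> {1..d}" using argmax_upto_le[of ?f d] by (simp add: light_def)
  show "size_of light \<le> size_of p"
    using *(1) \<open>light \<noteq> heavy\<close> \<open>light \<noteq> 0\<close> by (simp add: fun_upd_def)
qed

lemma light_range: "light \<in> {1..d}" and light_neq_heavy: "light \<noteq> heavy"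
proof -
  have "(if heavy = 1 then 2 else 1) \<in> {1..d}" "(if heavy = 1 then 2 else 1) \<noteq> heavy"
    using d by auto
  from light_max[OF this] show "light \<in> {1..d}" "light \<noteq> heavy" by auto
qed

lemma size_light_le: "p \<in> {1..d} \<Longrightarrow> p \<noteq> heavy \<Longrightarrow> size_of light \<le> size_of p"
  by (rule light_max)

theorem reaches_rounding:
  assumes s: "loaded s" "\<forall>v. nvar s v = 0 \<or> v = ''n'' \<or> v = ''d''" "\<forall>v. rvar s v = 0"
    "\<forall>v k. rarr s v k = 0 \<or> v = ''c'' \<or> v = ''x''" "draws s = 0"
  shows "reaches \<omega> rounding_com s (100 * (n + d))
    (\<lambda>s. \<forall>k<n. narr s ''out'' k = of_bool (chosen (\<omega> 0) (\<omega> 1) k))"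
proof -
  let ?w = "weight(0 := - 1)" and ?l = "(\<lambda>p. - size_of p)(0 := - 1 - real n)"
  let ?u = "\<omega> 0" and ?v = "\<omega> 1"
  let ?P0 = "\<lambda>s. loaded s \<and> rvar s ''a'' = 0 \<and> nvar s ''q'' = 0 \<and> draws s = 0 "
  let ?P1 = "\<lambda>s. ?P0 s \<and> nvar s ''b'' = 0"
  let ?P2 = "\<lambda>s. ?P1 s \<and> nvar s ''i'' = 0"
  let ?T = "\<lambda>s. assigned ?u ?v d (rarr s ''t'')"
  let ?adjust = "RArrAssign ''t'' (NVar ''j'')
            (RSub (RAdd (RArr ''t'' (NVar ''j'')) (RArr ''t'' (NVar ''i''))) (RVar ''a''))"
  let ?below = "\<lambda>s. loaded s \<and> nvar s ''i'' = light \<and> nvar s ''j'' = heavy \<and> ?T s \<and>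
      rvar s ''a'' \<in> below n ?v \<and> (\<forall>z\<in>below n ?v. z \<le> rvar s ''a'')"
  let ?adjusted = "\<lambda>s. loaded s \<and> (\<forall>k<n. chosen ?u ?v k \<longleftrightarrow> rarr s ''t'' (part k) \<le> x k)"
  let ?start = "\<lambda>s'. s' = s"
  have threshold_light: "threshold ?u ?v light = 2 / real d * ?v"
    using light_neq_heavy by (simp add: threshold_def level_def)

  have 1: "triple \<omega> ?start (for_com ''n'' weigh_com) (2 + n * (2 + cost weigh_com))
      (\<lambda>s. loaded s \<and> nvar s ''b'' = 0 \<and> rvar s ''a'' = 0 \<and> nvar s ''q'' = 0 \<and> draws s = 0 \<and>
       nvar s ''i'' = 0 \<and> nvar s ''j'' = 0 \<and>
       (\<forall>p. rarr s ''w'' p = weight p) \<and> (\<forall>p. rarr s ''l'' p = - size_of p))"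
    unfolding triple_def
  proof (intro allI impI, elim ssubst, rule reaches_weigh)
    show "nvar s ''b'' = 0" "nvar s ''q'' = 0" "nvar s ''i'' = 0" "nvar s ''j'' = 0"
      using s(2)[rule_format, of "''b''"] s(2)[rule_format, of "''q''"]
        s(2)[rule_format, of "''i''"] s(2)[rule_format, of "''j''"] by simp_all
    show "\<forall>p. rarr s ''w'' p = 0 \<and> rarr s ''l'' p = 0"
      using s(4)[rule_format, of "''w''"] s(4)[rule_format, of "''l''"] by simp
  qed (use s in simp_all)
  have 2: "triple \<omega>
      (\<lambda>s. loaded s \<and> nvar s ''b'' = 0 \<and> rvar s ''a'' = 0 \<and> nvar s ''q'' = 0 \<and> draws s = 0 \<and>
       nvar s ''i'' = 0 \<and> nvar s ''j'' = 0 \<and>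
       (\<forall>p. rarr s ''w'' p = weight p) \<and> (\<forall>p. rarr s ''l'' p = - size_of p))
      (Seq (RArrAssign ''w'' (NConst 0) (RConst (- 1)))
           (RArrAssign ''l'' (NConst 0) (RSub (RConst (- 1)) (ROfNat (NVar ''n''))))) 2
      (\<lambda>s. (?P2 s \<and> rarr s ''l'' = ?l) \<and> nvar s ''j'' = 0 \<and> rarr s ''w'' = ?w)"
    by (rule triple_wp[THEN triple_le]) (simp_all add: loaded_def fun_eq_iff)
  have 3: "triple \<omega> (\<lambda>s. (?P2 s \<and> rarr s ''l'' = ?l) \<and> nvar s ''j'' = 0 \<and> rarr s ''w'' = ?w)
      (argmax_com ''w'' ''j'') (2 + d * 4)
      (\<lambda>s. (?P2 s \<and> rarr s ''l'' = ?l) \<and> nvar s ''j'' = heavy)"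
    unfolding triple_def heavy_def
    by (intro allI impI, rule reaches_argmax[where P = "\<lambda>s. ?P2 s \<and> rarr s ''l'' = ?l"])
       (auto simp: loaded_def)
  have 4: "triple \<omega> (\<lambda>s. (?P2 s \<and> rarr s ''l'' = ?l) \<and> nvar s ''j'' = heavy)
      (RArrAssign ''l'' (NVar ''j'') (RSub (RConst (- 2)) (ROfNat (NVar ''n'')))) 1
      (\<lambda>s. (?P1 s \<and> nvar s ''j'' = heavy) \<and> nvar s ''i'' = 0 \<and>
        rarr s ''l'' = ?l(heavy := - 2 - real n))"
    by (rule triple_wp[THEN triple_le]) (simp_all add: loaded_def)
  have 5: "triple \<omega> (\<lambda>s. (?P1 s \<and> nvar s ''j'' = heavy) \<and> nvar s ''i'' = 0 \<and>
        rarr s ''l'' = ?l(heavy := - 2 - real n))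
      (argmax_com ''l'' ''i'') (2 + d * 4)
      (\<lambda>s. (?P1 s \<and> nvar s ''j'' = heavy) \<and> nvar s ''i'' = light)"
    unfolding triple_def light_def
    by (intro allI impI, rule reaches_argmax[where P = "\<lambda>s. ?P1 s \<and> nvar s ''j'' = heavy"])
       (auto simp: loaded_def)
  have 6: "triple \<omega> (\<lambda>s. (?P1 s \<and> nvar s ''j'' = heavy) \<and> nvar s ''i'' = light)
      (for_com ''d'' (NAssign ''b'' (NSub (NConst 1) (NVar ''b'')))) (2 + d * 3)
      (\<lambda>s. (?P0 s \<and> nvar s ''j'' = heavy \<and> nvar s ''i'' = light) \<and> nvar s ''b'' = of_bool (odd d))"
    unfolding triple_def
    by (intro allI impI, rule reaches_parity[where
          P = "\<lambda>s. ?P0 s \<and> nvar s ''j'' = heavy \<and> nvar s ''i'' = light"])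
       (auto simp: loaded_def)
  have 7: "triple \<omega>
      (\<lambda>s. (?P0 s \<and> nvar s ''j'' = heavy \<and> nvar s ''i'' = light) \<and> nvar s ''b'' = of_bool (odd d))
      draw_com (cost draw_com)
      (\<lambda>s. loaded s \<and> rvar s ''a'' = 0 \<and> nvar s ''q'' = 0 \<and>
      nvar s ''i'' = light \<and> nvar s ''j'' = heavy \<and> rvar s ''u'' = ?u \<and> rvar s ''w'' = ?v \<and>
      filled ?u ?v 0 (rarr s ''r''))"
    by (rule triple_wp, rule wp_draw) auto
  have 8: "triple \<omega>
      (\<lambda>s. loaded s \<and> rvar s ''a'' = 0 \<and> nvar s ''q'' = 0 \<and>
      nvar s ''i'' = light \<and> nvar s ''j'' = heavy \<and> rvar s ''u'' = ?u \<and> rvar s ''w'' = ?v \<and>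
      filled ?u ?v 0 (rarr s ''r''))
      (for_com ''d'' threshold_com) (2 + d * (2 + cost threshold_com))
      (\<lambda>s. loaded s \<and> rvar s ''a'' = 0 \<and> nvar s ''i'' = light \<and> nvar s ''j'' = heavy \<and> ?T s)"
    unfolding triple_def by (intro allI impI reaches_threshold) auto
  have 9: "triple \<omega>
      (\<lambda>s. loaded s \<and> rvar s ''a'' = 0 \<and> nvar s ''i'' = light \<and> nvar s ''j'' = heavy \<and> ?T s)
      (for_com ''n'' below_com) (2 + n * (2 + cost below_com)) ?below"
    unfolding triple_def
  proof (intro allI impI)
    fix s assume *: "loaded s \<and> rvar s ''a'' = 0 \<and> nvar s ''i'' = light \<and> nvar s ''j'' = heavy \<and> ?T s"
    then have "rarr s ''t'' light = 2 / real d * ?v"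
      using light_range threshold_light by (simp add: assigned_def)
    with * show "reaches \<omega> (for_com ''n'' below_com) s (2 + n * (2 + cost below_com)) ?below"
      by (intro reaches_below) auto
  qed
  have 10: "triple \<omega> ?below ?adjust 1 ?adjusted"
  proof (rule triple_wp[THEN triple_le])
    fix s assume *: "?below s"
    have t: "rarr s ''t'' heavy = threshold ?u ?v heavy" "rarr s ''t'' light = threshold ?u ?v light"
      "k < n \<Longrightarrow> rarr s ''t'' (part k) = threshold ?u ?v (part k)" for k
      using * light_range heavy_range part_range unfolding assigned_def by blast+
    \<comment> \<open>As \<open>a\<close> is the maximum of \<open>below\<close>, the existential in
      \<open>chosen\<close> becomes a comparison with the updated threshold.\<close>
    have ex: "(\<exists>z\<in>below n ?v. a \<le> b + z) \<longleftrightarrow> a \<le> b + rvar s ''a''" for a b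
      using * by force
    show "wp \<omega> ?adjust ?adjusted s"
      using * t by (simp add: loaded_def chosen_def ex diff_le_eq del: One_nat_def)
  qed simp
  have 11: "triple \<omega> ?adjusted (for_com ''n'' output_com) (2 + n * (2 + cost output_com))
     (\<lambda>s. \<forall>k<n. narr s ''out'' k = of_bool (chosen ?u ?v k))"
    unfolding triple_def
  proof (intro allI impI)
    fix s assume "?adjusted s"
    then show "reaches \<omega> (for_com ''n'' output_com) s (2 + n * (2 + cost output_com))
     (\<lambda>s. \<forall>k<n. narr s ''out'' k = of_bool (chosen ?u ?v k))"
      using reaches_output[of s "rarr s ''t''" \<omega>] by (auto simp: reaches_def)
  qed
  have "triple \<omega> ?start rounding_com
     ((2 + n * (2 + cost weigh_com)) + (2 + ((2 + d * 4) + (1 + ((2 + d * 4) + ((2 + d * 3) +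
      (cost draw_com + ((2 + d * (2 + cost threshold_com)) + ((2 + n * (2 + cost below_com)) +
      (1 + (2 + n * (2 + cost output_com))))))))))))
     (\<lambda>s. \<forall>k<n. narr s ''out'' k = of_bool (chosen ?u ?v k))"
    unfolding rounding_com_def
    by (rule triple_Seq[OF 1 triple_Seq[OF 2 triple_Seq[OF 3 triple_Seq[OF 4 triple_Seq[OF 5
      triple_Seq[OF 6 triple_Seq[OF 7 triple_Seq[OF 8 triple_Seq[OF 9 triple_Seq[OF 10 11]]]]]]]]]])
  then have "reaches \<omega> rounding_com s
     ((2 + n * (2 + cost weigh_com)) + (2 + ((2 + d * 4) + (1 + ((2 + d * 4) + ((2 + d * 3) +
      (cost draw_com + ((2 + d * (2 + cost threshold_com)) + ((2 + n * (2 + cost below_com)) +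
      (1 + (2 + n * (2 + cost output_com))))))))))))
     (\<lambda>s. \<forall>k<n. narr s ''out'' k = of_bool (chosen ?u ?v k))"
    unfolding triple_def by blast
  \<comment> \<open>The accumulated bound is \<open>13 * n + 18 * d + 26\<close>;
    \<open>4 \<le> d\<close> absorbs the constant term.\<close>
  then show ?thesis
    by (rule reaches_le)
       (use d in \<open>simp add: Let_def weigh_com_def draw_com_def threshold_com_def below_com_def output_com_def\<close>)
qed

end

section \<open>The random thresholds\<close>

abbreviation unit :: "real measure" where "unit \<equiv> restrict_space lborel {0..1}"

lemma prob_space_unit: "prob_space unit"
  by (rule prob_space_restrict_space) auto

interpretation tape: sequence_space unit
proof -
  interpret prob_space unit by (rule prob_space_unit)
  show "sequence_space unit" by unfold_locales
qed

lemma space_tape: "\<omega> \<in> space tape \<longleftrightarrow> (\<forall>i. \<omega> i \<in> {0..1})"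
  by (auto simp: tape_def space_PiM PiE_def Pi_iff space_restrict_space)

lemma measurable_tape [measurable]: "(\<lambda>\<omega>. \<omega> i) \<in> borel_measurable tape"
proof -
  have "(\<lambda>\<omega>. \<omega> i) \<in> measurable tape unit"
    unfolding tape_def by (rule measurable_component_singleton) simp
  then show ?thesis
    by (simp add: measurable_restrict_space2_iff)
qed

interpretation tape_prob: prob_space tape
  unfolding tape_def by (rule tape.P.prob_space_axioms)

definition unit_prob :: "real set \<Rightarrow> real" where
  "unit_prob A = measure lborel (A \<inter> {0..1})"

text \<open>The event is a cylinder over two indices of the product measure, hence the product
  formula. The gain rests on this independence of \<open>u\<close> and \<open>w\<close>.\<close>

lemma prob_two_coordinates:
  assumes "i \<noteq> j" and [measurable]: "A \<in> sets borel" "B \<in> sets borel"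
  shows "tape_prob.prob {\<omega>\<in>space tape. \<omega> i \<in> A \<and> \<omega> j \<in> B} = unit_prob A * unit_prob B"
proof -
  let ?X = "\<lambda>k. (if k = i then A else B) \<inter> {0..1}"
  have sets: "?X k \<in> sets unit" for k
    by (auto simp: sets_restrict_space)
  have "{\<omega>\<in>space tape. \<omega> i \<in> A \<and> \<omega> j \<in> B} = {\<omega>\<in>space tape. \<forall>k\<in>{i, j}. \<omega> k \<in> ?X k}"
    using assms(1) by (auto simp: space_tape)
  then have "emeasure tape {\<omega>\<in>space tape. \<omega> i \<in> A \<and> \<omega> j \<in> B} = (\<Prod>k\<in>{i, j}. emeasure unit (?X k))"
    using tape.emeasure_PiM_Collect[of "{i, j}" ?X] sets by (simp add: tape_def)
  also have "\<dots> = emeasure unit (A \<inter> {0..1}) * emeasure unit (B \<inter> {0..1})"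
    using assms(1) by simp
  also have "\<dots> = emeasure lborel (A \<inter> {0..1}) * emeasure lborel (B \<inter> {0..1})"
    by (simp add: emeasure_restrict_space)
  finally show ?thesis
    by (simp add: measure_def unit_prob_def enn2real_mult)
qed

lemma unit_prob_UNIV: "unit_prob UNIV = 1"
  by (simp add: unit_prob_def)

lemma prob_coordinate:
  assumes "A \<in> sets borel"
  shows "tape_prob.prob {\<omega>\<in>space tape. \<omega> i \<in> A} = unit_prob A"
  using prob_two_coordinates[of i "Suc i" A UNIV] assms by (simp add: unit_prob_UNIV)

lemma unit_prob_le:
  assumes "A \<inter> {0..1} \<subseteq> B" "A \<in> sets borel" "B \<in> sets borel" "bounded B"
  shows "unit_prob A \<le> measure lborel B"
  unfolding unit_prob_def
  using assms by (intro measure_mono_fmeasurable) (auto intro: fmeasurableI emeasure_bounded_finite)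

lemma unit_prob_le_1: "A \<in> sets borel \<Longrightarrow> unit_prob A \<le> 1"
  using unit_prob_le[of A "{0..1}"] by simp

lemma unit_prob_Icc_le:
  assumes "A \<inter> {0..1} \<subseteq> {a..b}" "A \<in> sets borel" "a \<le> b"
  shows "unit_prob A \<le> b - a"
  using unit_prob_le[OF assms(1,2)] assms(3) by simp

lemma unit_prob_two_Icc_le:
  assumes "A \<inter> {0..1} \<subseteq> {a..b} \<union> {a'..b'}" "A \<in> sets borel" "a \<le> b" "a' \<le> b'"
  shows "unit_prob A \<le> (b - a) + (b' - a')"
proof -
  have "unit_prob A \<le> measure lborel ({a..b} \<union> {a'..b'})"
    using assms by (intro unit_prob_le) auto
  also have "\<dots> \<le> measure lborel {a..b} + measure lborel {a'..b'}"
    by (intro measure_Un_le) auto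
  finally show ?thesis using assms by simp
qed

text \<open>One-sided uniformity: an upper bound on the distribution function is what an upper bound
  on a selection probability asks for. Arguments beyond 1 are included because
  \<open>d / 2 * x k\<close> is unbounded.\<close>

definition subuniform :: "(real \<Rightarrow> real) \<Rightarrow> bool" where
  "subuniform X \<longleftrightarrow> X \<in> borel_measurable borel \<and> (\<forall>y\<ge>0. unit_prob {u. X u \<le> y} \<le> y)"

lemma subuniform_id: "subuniform (\<lambda>u. u)"
  unfolding subuniform_def
proof (intro conjI allI impI)
  fix y :: real assume "0 \<le> y"
  then have "unit_prob {u. u \<le> y} \<le> y - 0"
    by (intro unit_prob_Icc_le) auto
  then show "unit_prob {u. u \<le> y} \<le> y" by simp
qed simp

lemma subuniform_flip: "subuniform (\<lambda>u. 1 - u)"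
  unfolding subuniform_def
proof (intro conjI allI impI)
  fix y :: real assume "0 \<le> y"
  then have "unit_prob {u. 1 - u \<le> y} \<le> 1 - (1 - y)"
    by (intro unit_prob_Icc_le) auto
  then show "unit_prob {u. 1 - u \<le> y} \<le> y" by simp
qed simp

lemma subuniform_rot_half: "subuniform rot_half"
  unfolding subuniform_def
proof (intro conjI allI impI)
  show *[measurable]: "rot_half \<in> borel_measurable borel"
    unfolding rot_half_def by measurable
  fix y :: real assume "0 \<le> y"
  show "unit_prob {u. rot_half u \<le> y} \<le> y"
  \<comment> \<open>For \<open>y < 1 / 2\<close> only a piece of the upper half qualifies; otherwise
    the whole upper half does, together with an initial piece of the lower half.\<close>
  proof (cases "y < 1 / 2")
    case True
    have "unit_prob {u. rot_half u \<le> y} \<le> (y + 1 / 2) - 1 / 2"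
      using True \<open>0 \<le> y\<close> by (intro unit_prob_Icc_le) (auto simp: rot_half_def split: if_splits)
    then show ?thesis by simp
  next
    case False
    have "unit_prob {u. rot_half u \<le> y} \<le> ((y - 1 / 2) - 0) + (1 - 1 / 2)"
      using False by (intro unit_prob_two_Icc_le) (auto simp: rot_half_def split: if_splits)
    then show ?thesis by simp
  qed
qed

lemma subuniform_fold_back: "subuniform fold_back"
  unfolding subuniform_def
proof (intro conjI allI impI)
  show *[measurable]: "fold_back \<in> borel_measurable borel"
    unfolding fold_back_def by measurable
  fix y :: real assume "0 \<le> y"
  \<comment> \<open>Each half carries one linear piece of slope -2 and so contributes at most
    \<open>y / 2\<close>.\<close>
  have "unit_prob {u. fold_back u \<le> y} \<le> (1 / 2 - (1 - y) / 2) + (1 - (1 - y / 2))"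
    using \<open>0 \<le> y\<close>
    by (intro unit_prob_two_Icc_le) (auto simp: fold_back_def field_simps split: if_splits)
  then show "unit_prob {u. fold_back u \<le> y} \<le> y" by (simp add: field_simps)
qed

lemma filler_late: "(\<forall>u w. filler b u w (q + 3) = u) \<or> (\<forall>u w. filler b u w (q + 3) = 1 - u)"
proof (induction q)
  case 0
  then show ?case by (cases b) (auto simp: numeral_eq_Suc)
next
  case (Suc q)
  have "filler b u w (Suc q + 3) = 1 - filler b u w (q + 3)" for u w
    by (simp add: numeral_eq_Suc)
  then show ?case using Suc by auto
qed

lemma nat_lt3_cases: "q = 0 \<or> q = 1 \<or> q = 2 \<or> (\<exists>r. q = r + (3::nat))"
proof (cases "3 \<le> q")
  case True
  then have "q = (q - 3) + 3" by simp
  then show ?thesis by blast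
qed auto

text \<open>Each filler depends on a single coordinate. By linearity of expectation, only the
  marginal laws of the parts other than \<open>heavy\<close> and \<open>light\<close> enter the
  cost, so the strong dependence among their levels is harmless.\<close>

lemma subuniform_filler:
  "\<exists>X. subuniform X \<and> ((\<forall>u w. filler b u w q = X w) \<or> (\<forall>u w. filler b u w q = X u))"
proof -
  consider "q = 0" | "q = 1" | "q = 2" | r where "q = r + 3" using nat_lt3_cases[of q] by blast
  then show ?thesis
  proof cases
    case 1
    then show ?thesis using subuniform_flip by (intro exI[of _ "\<lambda>u. 1 - u"]) (simp add: filler_less_4)
  next
    case 2
    then show ?thesis using subuniform_flip subuniform_rot_half
      by (intro exI[of _ "if b then rot_half else (\<lambda>u. 1 - u)"]) (simp add: filler_less_4)
  next
    case 3
    then show ?thesis using subuniform_id subuniform_fold_back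
      by (intro exI[of _ "if b then fold_back else (\<lambda>u. u)"]) (simp add: filler_less_4)
  next
    case 4
    from filler_late[of b r] show ?thesis
    proof
      assume "\<forall>u w. filler b u w (r + 3) = u"
      with subuniform_id show ?thesis unfolding 4 by (intro exI[of _ "\<lambda>u. u"]) simp
    next
      assume "\<forall>u w. filler b u w (r + 3) = 1 - u"
      with subuniform_flip show ?thesis unfolding 4 by (intro exI[of _ "\<lambda>u. 1 - u"]) simp
    qed
  qed
qed

lemma filler_nonneg:
  assumes "u \<in> {0..1}" "w \<in> {0..1}"
  shows "0 \<le> filler b u w q"
proof -
  consider "q = 0" | "q = 1" | "q = 2" | r where "q = r + 3" using nat_lt3_cases[of q] by blast
  then show ?thesis
  proof cases
    case 4
    from filler_late[of b r] show ?thesis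
      unfolding 4 by (elim disjE) (use assms in simp_all)
  qed (use assms in \<open>auto simp: filler_less_4 rot_half_def fold_back_def\<close>)
qed

lemma level_nonneg: "u \<in> {0..1} \<Longrightarrow> w \<in> {0..1} \<Longrightarrow> 0 \<le> level b i j u w p"
  using filler_nonneg by (simp add: level_def)

lemma subuniform_level:
  "\<exists>X k. subuniform X \<and> (\<forall>\<omega>. level b i j (\<omega> 0) (\<omega> 1) p = X (\<omega> (k::nat)))"
proof -
  obtain X where X: "subuniform X" "(\<forall>u w. filler b u w (slot i j (p - 1)) = X w) \<or>
      (\<forall>u w. filler b u w (slot i j (p - 1)) = X u)"
    using subuniform_filler by blast
  consider "p = j" | "p \<noteq> j" "p = i" | "p \<noteq> j" "p \<noteq> i" by blast
  then show ?thesis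
  proof cases
    case 1
    then show ?thesis
      using subuniform_id by (intro exI[of _ "\<lambda>u. u"] exI[of _ 0]) (simp add: level_def)
  next
    case 2
    then show ?thesis
      using subuniform_id by (intro exI[of _ "\<lambda>u. u"] exI[of _ 1]) (simp add: level_def)
  next
    case 3
    from X(2) show ?thesis
    proof
      assume "\<forall>u w. filler b u w (slot i j (p - 1)) = X w"
      with X(1) 3 show ?thesis
        by (intro exI[of _ X] exI[of _ 1]) (simp add: level_def)
    next
      assume "\<forall>u w. filler b u w (slot i j (p - 1)) = X u"
      with X(1) 3 show ?thesis
        by (intro exI[of _ X] exI[of _ 0]) (simp add: level_def)
    qed
  qed
qed

lemma measurable_level [measurable]:
  "(\<lambda>\<omega>. level b i j (\<omega> 0) (\<omega> 1) p) \<in> borel_measurable tape"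
proof -
  obtain X k where X: "subuniform X" "\<And>\<omega>. level b i j (\<omega> 0) (\<omega> 1) p = X (\<omega> (k::nat))"
    using subuniform_level[of b i j p] by blast
  then have [measurable]: "X \<in> borel_measurable borel" by (simp add: subuniform_def)
  show ?thesis unfolding X(2) by measurable
qed

lemma prob_level_le:
  assumes "0 \<le> y"
  shows "tape_prob.prob {\<omega>\<in>space tape. level b i j (\<omega> 0) (\<omega> 1) p \<le> y} \<le> y"
proof -
  obtain X k where X: "subuniform X" "\<And>\<omega>. level b i j (\<omega> 0) (\<omega> 1) p = X (\<omega> (k::nat))"
    using subuniform_level[of b i j p] by blast
  then have [measurable]: "X \<in> borel_measurable borel" by (simp add: subuniform_def)
  show ?thesis
    using prob_coordinate[of "{u. X u \<le> y}" k] X assms unfolding X(2) by (simp add: subuniform_def)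
qed

section \<open>The levels add up to d / 2\<close>

lemma slot_add: "i \<noteq> j \<Longrightarrow> slot i j k + of_bool (1 \<le> i \<and> i \<le> k) + of_bool (1 \<le> j \<and> j \<le> k) = k"
  by (induction k) (auto simp: le_Suc_eq)

text \<open>\<open>slot\<close> numbers the parts other than \<open>i\<close> and \<open>j\<close>
  consecutively from 0, so the sum reindexes to an initial segment.\<close>

lemma sum_slot:
  fixes F :: "nat \<Rightarrow> real"
  shows "(\<Sum>p=1..k. if p = j \<or> p = i then 0 else F (slot i j (p - 1))) = (\<Sum>q<slot i j k. F q)"
  by (induction k) auto

lemma sum_filler_even: "(\<Sum>q<2 * r + 2. filler False u w q) = 2 - w - u + real r"
proof (induction r)
  case 0
  then show ?case by (simp add: numeral_eq_Suc)
next
  case (Suc r)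
  have "filler False u w (2 * r + 2) + filler False u w (2 * r + 3) = 1"
    \<comment> \<open>The pair at positions 2 and 3 comes from explicit clauses of
      \<open>filler\<close>, every later pair from the recursive one.\<close>
    by (cases r) (simp_all add: numeral_eq_Suc)
  then show ?case using Suc by (simp add: numeral_eq_Suc)
qed

text \<open>The base case is \<open>1 - w\<close> plus the triple identity
  \<open>u + rot_half u + fold_back u = 3 / 2\<close>; every later pair adds 1.\<close>

lemma sum_filler_odd: "(\<Sum>q<2 * r + 3. filler True u w q) = 5 / 2 - w - u + real r"
proof (induction r)
  case 0
  then show ?case by (simp add: numeral_eq_Suc rot_half_def fold_back_def)
next
  case (Suc r)
  have "filler True u w (2 * r + 3) + filler True u w (2 * r + 4) = 1"
    by (simp add: numeral_eq_Suc)
  then show ?case using Suc by (simp add: numeral_eq_Suc)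
qed

lemma sum_filler:
  assumes "4 \<le> d"
  shows "(\<Sum>q<d - 2. filler (odd d) u w q) = real d / 2 - u - w"
proof (cases "odd d")
  case True
  then obtain k where "d = 2 * k + 1" by (rule oddE)
  moreover define r where "r = k - 2"
  ultimately have "d = 2 * r + 5" using assms by simp
  then show ?thesis using sum_filler_odd[of u w r] by (simp add: field_simps)
next
  case False
  then obtain k where "d = 2 * k" by (auto elim: evenE)
  moreover define r where "r = k - 2"
  ultimately have "d = 2 * r + 4" using assms by simp
  then show ?thesis using sum_filler_even[of u w r] by (simp add: field_simps)
qed

lemma sum_level:
  assumes "4 \<le> d" "i \<in> {1..d}" "j \<in> {1..d}" "i \<noteq> j"
  shows "(\<Sum>p=1..d. level (odd d) i j u w p) = real d / 2"
proof -
  let ?F = "filler (odd d) u w"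
  have "(\<Sum>p=1..d. level (odd d) i j u w p) = (\<Sum>p=1..d. (if p = j then u else 0) +
      ((if p = i then w else 0) + (if p = j \<or> p = i then 0 else ?F (slot i j (p - 1)))))"
    using assms(4) by (intro sum.cong) (auto simp: level_def)
  also have "\<dots> = u + (w + (\<Sum>q<slot i j d. ?F q))"
    using assms(2,3) unfolding sum.distrib sum_slot by simp
  also have "slot i j d = d - 2"
    using slot_add[of i j d] assms by simp
  finally show ?thesis using sum_filler[OF assms(1), of u w] by simp
qed

section \<open>Feasibility and expected cost\<close>

context rounding_instance
begin

lemma threshold_nonneg: "u \<in> {0..1} \<Longrightarrow> w \<in> {0..1} \<Longrightarrow> 0 \<le> threshold u w p"
  unfolding threshold_def by (intro mult_nonneg_nonneg level_nonneg) auto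

lemma sum_threshold: "(\<Sum>p=1..d. threshold u w p) = 1"
  unfolding threshold_def sum_distrib_left[symmetric]
    sum_level[OF d light_range heavy_range light_neq_heavy]
  using d by simp

lemma threshold_light: "threshold u w light = 2 / real d * w"
  using light_neq_heavy by (simp add: threshold_def level_def)

lemma threshold_heavy: "threshold u w heavy = 2 / real d * u"
  by (simp add: threshold_def level_def)

text \<open>Lovasz's argument: the vertices lie in distinct parts, so distinct entries of
  \<open>b\<close> bound their values, and these entries have total at most 1. One strict inequality
  makes the sum strictly smaller.\<close>

lemma sum_transversal_less_1:
  assumes I: "I \<subseteq> {..<n}" "inj_on part I"
    and B: "\<And>k. k \<in> I \<Longrightarrow> x k \<le> b (part k)" "k\<^sub>0 \<in> I" "x k\<^sub>0 < b (part k\<^sub>0)"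
      "\<And>p. p \<in> {1..d} \<Longrightarrow> 0 \<le> b p" "(\<Sum>p=1..d. b p) = 1"
  shows "(\<Sum>k\<in>I. x k) < 1"
proof -
  have "finite I" using I(1) finite_subset by blast
  have "(\<Sum>k\<in>I. x k) < (\<Sum>k\<in>I. b (part k))"
    using \<open>finite I\<close> B(1-3) by (intro sum_strict_mono_ex1) auto
  also have "\<dots> = (\<Sum>p\<in>part ` I. b p)"
    using I(2) by (simp add: sum.reindex)
  also have "\<dots> \<le> (\<Sum>p=1..d. b p)"
    using I(1) part_range B(4) by (intro sum_mono2) (auto simp: subset_iff)
  finally show ?thesis using B(5) by simp
qed

text \<open>If no vertex is chosen, the values in \<open>I\<close> stay below thresholds of total 1,
  a contradiction. Without a vertex in \<open>heavy\<close> these are the original thresholds;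
  otherwise slack is moved from \<open>light\<close> to \<open>heavy\<close>.\<close>

lemma transversal_chosen:
  assumes u: "u \<in> {0..1}" and w: "w \<in> {0..1}"
    and I: "I \<subseteq> {..<n}" "inj_on part I" and sum: "1 \<le> (\<Sum>k\<in>I. x k)"
  shows "\<exists>k\<in>I. chosen u w k"
proof (rule ccontr)
  assume no: "\<not> ?thesis"
  let ?t = "threshold u w"
  have regular: "x k < ?t (part k)" if "k \<in> I" "part k \<noteq> heavy" for k
    using no that by (auto simp: chosen_def)
  show False
  proof (cases "heavy \<in> part ` I")
    case False
    obtain k\<^sub>0 where "k\<^sub>0 \<in> I" using sum by fastforce
    have strict: "x k < ?t (part k)" if "k \<in> I" for k
    proof -
      have "part k \<noteq> heavy" using False that by (metis imageI)
      with regular[OF that] show ?thesis .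
    qed
    have "(\<Sum>k\<in>I. x k) < 1"
    proof (rule sum_transversal_less_1[OF I, of ?t k\<^sub>0])
      show "x k\<^sub>0 < ?t (part k\<^sub>0)" using strict[OF \<open>k\<^sub>0 \<in> I\<close>] .
    qed (use strict[THEN less_imp_le] \<open>k\<^sub>0 \<in> I\<close> threshold_nonneg[OF u w] sum_threshold in auto)
    with sum show False by simp
  next
    case True
    then obtain h where h: "h \<in> I" "part h = heavy" by auto
    \<comment> \<open>\<open>a\<close> is the value of the vertex of \<open>I\<close> in
      \<open>light\<close>, or 0 if there is none; it need not be the maximum of
      \<open>below\<close>.\<close>
    obtain a where a: "a \<in> below n w" "\<And>l. l \<in> I \<Longrightarrow> part l = light \<Longrightarrow> x l = a"
      "0 \<le> a" "a \<le> ?t light"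
    proof (cases "\<exists>l\<in>I. part l = light")
      case True
      then obtain l where l: "l \<in> I" "part l = light" by blast
      then have "x l < ?t light" "0 \<le> x l"
        using regular[of l] light_neq_heavy x_nonneg[of l] I(1) by auto
      with l show ?thesis
        using I by (intro that[of "x l"]) (auto simp: below_def threshold_light inj_on_def)
    next
      case False
      then show ?thesis
        using threshold_nonneg[OF u w] by (intro that[of 0]) (auto simp: below_def)
    qed
    \<comment> \<open>Lowering \<open>light\<close> to \<open>a\<close> and raising
      \<open>heavy\<close> by the same amount keeps the total at 1.\<close>
    define b where "b = ?t(heavy := ?t heavy + ?t light - a, light := a)"
    have "b = (\<lambda>p. ?t p + (if p = heavy then ?t light - a else 0) + (if p = light then a - ?t light else 0))"
      using light_neq_heavy by (auto simp: b_def)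
    then have "(\<Sum>p=1..d. b p) = 1"
      using heavy_range light_range by (simp add: sum.distrib sum_threshold[simplified])
    \<comment> \<open>That \<open>h\<close> is not chosen gives the inequality for every element of
      \<open>below\<close>, in particular for \<open>a\<close>.\<close>
    moreover have "x h < b (part h)"
      using no h a(1) light_neq_heavy by (fastforce simp: chosen_def b_def)
    moreover have "0 \<le> b p" for p
      using a(3,4) threshold_nonneg[OF u w, of p] threshold_nonneg[OF u w, of heavy]
      by (auto simp: b_def)
    moreover have "x k \<le> b (part k)" if "k \<in> I" for k
    proof (cases "part k = heavy")
      case True
      then have "k = h" using I(2) h that by (auto simp: inj_on_def)
      then show ?thesis using \<open>x h < b (part h)\<close> by simp
    next
      case False
      then show ?thesis using regular[OF that] a(2)[OF that] by (auto simp: b_def)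
    qed
    ultimately have "(\<Sum>k\<in>I. x k) < 1"
      using h(1) by (intro sum_transversal_less_1[OF I, of b h])
    with sum show False by simp
  qed
qed

section \<open>Measurability and probability of selecting a vertex\<close>

lemma chosen_heavy_iff:
  "part k = heavy \<Longrightarrow> chosen u w k \<longleftrightarrow>
    threshold u w heavy + threshold u w light \<le> x k \<or>
    (\<exists>l\<in>{..<n}. part l = light \<and> x l < 2 / real d * w \<and>
       threshold u w heavy + threshold u w light \<le> x k + x l)"
  by (auto simp: chosen_def below_def)

lemma measurable_threshold [measurable]:
  "(\<lambda>\<omega>. threshold (\<omega> 0) (\<omega> 1) p) \<in> borel_measurable tape"
  unfolding threshold_def using measurable_level by (intro borel_measurable_times) auto

lemma measurable_chosen [measurable]: "Measurable.pred tape (\<lambda>\<omega>. chosen (\<omega> 0) (\<omega> 1) k)"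
proof (cases "part k = heavy")
  case True
  show ?thesis unfolding chosen_heavy_iff[OF True]
    using measurable_threshold[of heavy] measurable_threshold[of light] by measurable
next
  case False
  then show ?thesis
    using measurable_threshold[of "part k"] unfolding chosen_def by simp
qed

lemma prob_chosen_le:
  assumes "k < n" "part k \<noteq> heavy"
  shows "tape_prob.prob {\<omega>\<in>space tape. chosen (\<omega> 0) (\<omega> 1) k} \<le> real d / 2 * x k"
proof -
  have "chosen u w k \<longleftrightarrow> level (odd d) light heavy u w (part k) \<le> real d / 2 * x k" for u w
    using d assms(2) by (simp add: chosen_def threshold_def field_simps)
  then show ?thesis
    using prob_level_le[of "real d / 2 * x k"] x_nonneg[OF assms(1)] by simp
qed

text \<open>The saving must be proportional to \<open>y\<close>. For \<open>y \<le> 2\<close> the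
  length \<open>y - s\<close> suffices, since \<open>s \<ge> y * s / 2\<close>; for larger
  \<open>y\<close> the trivial bound 1 is below \<open>y / 2\<close>.\<close>

lemma unit_prob_initial_le:
  assumes "0 \<le> s" "s \<le> 1" "0 \<le> y"
  shows "unit_prob {..y - s} \<le> y * (1 - s / 2)"
proof -
  consider "y < s" | "s \<le> y" "y \<le> 2" | "2 < y" by linarith
  then show ?thesis
  proof cases
    case 1
    then have "{..y - s} \<inter> {0..1} = {}" by auto
    then show ?thesis using assms by (simp add: unit_prob_def)
  next
    case 2
    have "unit_prob {..y - s} \<le> (y - s) - 0"
      using 2 by (intro unit_prob_Icc_le) auto
    also have "\<dots> \<le> y * (1 - s / 2)"
      using mult_right_mono[OF 2(2) assms(1)] by (simp add: algebra_simps)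
    finally show ?thesis .
  next
    case 3
    have "unit_prob {..y - s} \<le> 1" by (rule unit_prob_le_1) simp
    also have "1 \<le> y * (1 / 2)" using 3 by simp
    also have "\<dots> \<le> y * (1 - s / 2)" using assms by (intro mult_left_mono) auto
    finally show ?thesis .
  qed
qed

text \<open>In units of \<open>2 / d\<close>, selection requires \<open>u + w \<le> y + z\<close>
  for some \<open>z \<le> w\<close> in \<open>Z\<close>, so always \<open>u \<le> y\<close>. Unless
  \<open>w\<close> is at most \<open>s\<close> above a point of \<open>Z\<close>, even
  \<open>u < y - s\<close> holds.\<close>

lemma prob_chosen_heavy_le:
  assumes k: "k < n" "part k = heavy"
  shows "tape_prob.prob {\<omega>\<in>space tape. chosen (\<omega> 0) (\<omega> 1) k}
    \<le> real d / 2 * x k * (1 - 1 / (8 * (size_of light + 1)))"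
proof -
  define m where "m = size_of light + 1"
  \<comment> \<open>\<open>Z\<close> has at most \<open>m\<close> points, so the intervals of length
    \<open>s\<close> above them have total measure at most 1/2.\<close>
  define s where "s = 1 / (2 * m)"
  define y where "y = real d / 2 * x k"
  define L where "L = {l. l < n \<and> part l = light}"
  define Z where "Z = insert 0 ((\<lambda>l. real d / 2 * x l) ` L)"
  define bad where "bad = (\<Union>z\<in>Z. {z..z + s})"
  have "1 \<le> m" using size_of_bounds(1)[of light] by (simp add: m_def)
  then have s: "0 \<le> s" "s \<le> 1" by (auto simp: s_def)
  have y: "0 \<le> y" using x_nonneg[OF k(1)] by (simp add: y_def)
  have "finite L" by (simp add: L_def)
  then have "finite Z" by (simp add: Z_def)
  have "size_of light = real (card L)"
    unfolding size_of_def L_def by (simp add: sum.If_cases Int_def)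
  then have "real (card Z) \<le> m"
    using card_image_le[OF \<open>finite L\<close>, of "\<lambda>l. real d / 2 * x l"] \<open>finite L\<close>
    by (simp add: Z_def m_def card_insert_if)
  have [measurable]: "bad \<in> sets borel"
    unfolding bad_def using \<open>finite Z\<close> by (intro sets.finite_UN) auto
  have "unit_prob bad \<le> measure lborel bad"
    unfolding bad_def using \<open>finite Z\<close> by (intro unit_prob_le sets.finite_UN) auto
  also have "\<dots> \<le> (\<Sum>z\<in>Z. measure lborel {z..z + s})"
    unfolding bad_def using \<open>finite Z\<close> by (intro measure_UNION_le) auto
  also have "\<dots> = real (card Z) * s" using s by simp
  also have "\<dots> \<le> m * s" using \<open>real (card Z) \<le> m\<close> s by (intro mult_right_mono) auto
  also have "\<dots> = 1 / 2" using \<open>1 \<le> m\<close> by (simp add: s_def)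
  finally have bad: "unit_prob bad \<le> 1 / 2" .

  let ?low = "{\<omega>\<in>space tape. \<omega> 0 \<in> {..y - s}}"
  let ?mid = "{\<omega>\<in>space tape. \<omega> 0 \<in> {y - s<..y} \<and> \<omega> 1 \<in> bad}"
  let ?mid' = "{\<omega>\<in>space tape. \<omega> 0 \<in> {y - s<..y}}"
  have [measurable]: "?low \<in> sets tape" "?mid \<in> sets tape" "?mid' \<in> sets tape" by measurable
  have "{\<omega>\<in>space tape. chosen (\<omega> 0) (\<omega> 1) k} \<subseteq> ?low \<union> ?mid"
  proof
    fix \<omega> assume "\<omega> \<in> {\<omega>\<in>space tape. chosen (\<omega> 0) (\<omega> 1) k}"
    then have \<omega>: "\<omega> \<in> space tape" "chosen (\<omega> 0) (\<omega> 1) k" by auto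
    obtain z where z: "z \<in> below n (\<omega> 1)"
        "threshold (\<omega> 0) (\<omega> 1) heavy + threshold (\<omega> 0) (\<omega> 1) light \<le> x k + z"
      using \<omega>(2) k(2) by (auto simp: chosen_def)
    define z' where "z' = real d / 2 * z"
    have "z' \<in> Z"
      using z(1) by (auto simp: z'_def Z_def L_def below_def)
    have "0 \<le> \<omega> 1" using \<omega>(1) by (simp add: space_tape)
    then have "z' \<le> \<omega> 1"
      using z(1) d by (auto simp: z'_def below_def field_simps)
    have "\<omega> 0 + \<omega> 1 \<le> y + z'"
      using z(2) d by (simp add: threshold_light threshold_heavy y_def z'_def field_simps)
    then have "\<omega> 0 \<le> y" using \<open>z' \<le> \<omega> 1\<close> by simp
    moreover have "\<omega> 1 \<in> bad" if "y - s < \<omega> 0"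
      using that \<open>\<omega> 0 + \<omega> 1 \<le> y + z'\<close> \<open>z' \<le> \<omega> 1\<close> \<open>z' \<in> Z\<close> unfolding bad_def
      by (intro UN_I[of z']) auto
    ultimately show "\<omega> \<in> ?low \<union> ?mid" using \<omega>(1) by force
  qed
  then have "tape_prob.prob {\<omega>\<in>space tape. chosen (\<omega> 0) (\<omega> 1) k} \<le> tape_prob.prob (?low \<union> ?mid)"
    by (intro tape_prob.finite_measure_mono) auto
  also have "\<dots> \<le> tape_prob.prob ?low + tape_prob.prob ?mid"
    by (intro measure_Un_le) auto
  also have "tape_prob.prob ?mid = tape_prob.prob ?mid' * unit_prob bad"
    using prob_two_coordinates[of 0 1 "{y - s<..y}" bad] prob_coordinate[of "{y - s<..y}" 0] by simp
  also have "\<dots> \<le> tape_prob.prob ?mid' * (1 / 2)"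
    using bad by (intro mult_left_mono) auto
  \<comment> \<open>The bound is the average of the probabilities of \<open>u \<le> y - s\<close>
    and \<open>u \<le> y\<close>, which are at most \<open>y * (1 - s / 2)\<close> and
    \<open>y\<close>; hence the factor \<open>1 - s / 4\<close>.\<close>
  also have "tape_prob.prob ?low + \<dots> = (tape_prob.prob ?low + (tape_prob.prob ?low + tape_prob.prob ?mid')) / 2"
    by simp
  also have "tape_prob.prob ?low + tape_prob.prob ?mid' = tape_prob.prob (?low \<union> ?mid')"
    by (intro tape_prob.finite_measure_Union[symmetric]) auto
  also have "?low \<union> ?mid' = {\<omega>\<in>space tape. \<omega> 0 \<in> {..y}}"
    using s by auto
  also have "tape_prob.prob \<dots> = unit_prob {..y}" by (rule prob_coordinate) simp
  also have "\<dots> \<le> y * (1 - 0 / 2)"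
    using unit_prob_initial_le[of 0 y] y by simp
  also have "tape_prob.prob ?low = unit_prob {..y - s}" by (rule prob_coordinate) simp
  also have "\<dots> \<le> y * (1 - s / 2)" using unit_prob_initial_le s y .
  finally have "tape_prob.prob {\<omega>\<in>space tape. chosen (\<omega> 0) (\<omega> 1) k} \<le> y * (1 - s / 4)"
    by (simp add: algebra_simps)
  also have "s / 4 = 1 / (8 * m)" by (simp add: s_def)
  finally show ?thesis by (simp add: y_def m_def)
qed

section \<open>The weight of \<open>heavy\<close> against the size of \<open>light\<close>\<close>

lemma sum_weight: "(\<Sum>k<n. c k * x k) = (\<Sum>p\<in>part ` {..<n}. weight p)"
  unfolding weight_def by (subst sum.swap) (simp add: sum.delta' flip: sum.delta)

lemma sum_size_of: "(\<Sum>p=1..d. size_of p) = real n"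
proof -
  have "(\<Sum>p=1..d. size_of p) = (\<Sum>k<n. \<Sum>p=1..d. if part k = p then 1 else 0)"
    unfolding size_of_def by (rule sum.swap)
  also have "\<dots> = (\<Sum>k<n. 1)"
    using part_range by (intro sum.cong) (auto simp: sum.delta')
  finally show ?thesis by simp
qed

text \<open>\<open>light\<close> is smallest among the \<open>d - 1\<close> parts other than
  \<open>heavy\<close>, hence at most their average.\<close>

lemma size_light_bound: "(real d - 1) * size_of light \<le> real n"
proof -
  have "(real d - 1) * size_of light = (\<Sum>p\<in>{1..d} - {heavy}. size_of light)"
    using heavy_range d by (simp add: of_nat_diff)
  also have "\<dots> \<le> (\<Sum>p\<in>{1..d} - {heavy}. size_of p)"
    using size_light_le by (intro sum_mono) auto
  also have "\<dots> \<le> (\<Sum>p=1..d. size_of p)"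
    using size_of_bounds(1) by (intro sum_mono2) auto
  finally show ?thesis by (simp add: sum_size_of[simplified])
qed

text \<open>\<open>heavy\<close> carries at least the average weight of the nonempty parts, and the
  number of these times \<open>size_of light + 1\<close> is at most \<open>4 * n\<close>.\<close>

lemma heavy_gain: "(\<Sum>k<n. c k * x k) * (size_of light + 1) \<le> 4 * real n * weight heavy"
proof -
  let ?P = "part ` {..<n}"
  have P: "?P \<subseteq> {1..d}" using part_range by auto
  have "card ?P \<le> n" using card_image_le[of "{..<n}" part] by simp
  moreover have "card ?P \<le> d" using card_mono[OF _ P] by simp
  \<comment> \<open>The number of nonempty parts is bounded by \<open>d\<close> next to
    \<open>size_of light\<close> and by \<open>n\<close> next to the summand 1.\<close>
  ultimately have "real (card ?P) * (size_of light + 1) \<le> real d * size_of light + real n"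
    using size_of_bounds(1)[of light]
    by (simp add: distrib_left add_mono mult_right_mono)
  also have "\<dots> \<le> 4 * real n"
  proof -
    have "real d * size_of light \<le> 2 * ((real d - 1) * size_of light)"
      using d size_of_bounds(1)[of light] mult_right_mono[of "real d" "2 * (real d - 1)" "size_of light"]
      by (simp add: algebra_simps)
    then show ?thesis using size_light_bound by simp
  qed
  finally have *: "real (card ?P) * (size_of light + 1) \<le> 4 * real n" .
  have "(\<Sum>k<n. c k * x k) \<le> (\<Sum>p\<in>?P. weight heavy)"
    unfolding sum_weight using P weight_le_heavy by (intro sum_mono) auto
  then have "(\<Sum>k<n. c k * x k) \<le> real (card ?P) * weight heavy" by simp
  then have "(\<Sum>k<n. c k * x k) * (size_of light + 1) \<le> real (card ?P) * weight heavy * (size_of light + 1)"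
    using size_of_bounds(1)[of light] by (intro mult_right_mono) auto
  also have "\<dots> = (real (card ?P) * (size_of light + 1)) * weight heavy" by simp
  also have "\<dots> \<le> 4 * real n * weight heavy"
    using * weight_nonneg by (intro mult_right_mono) auto
  finally show ?thesis .
qed

theorem expected_cost:
  "(\<Sum>k<n. c k * tape_prob.prob {\<omega>\<in>space tape. chosen (\<omega> 0) (\<omega> 1) k})
    \<le> (real d / 2 - real d / (64 * real n)) * (\<Sum>k<n. c k * x k)"
proof -
  let ?g = "1 / (8 * (size_of light + 1))"
  let ?W = "\<Sum>k<n. c k * x k"
  have "(\<Sum>k<n. c k * tape_prob.prob {\<omega>\<in>space tape. chosen (\<omega> 0) (\<omega> 1) k})
      \<le> (\<Sum>k<n. real d / 2 * (c k * x k) - real d / 2 * ?g * (if part k = heavy then c k * x k else 0))"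
  proof (rule sum_mono)
    fix k assume "k \<in> {..<n}"
    then have "c k * tape_prob.prob {\<omega>\<in>space tape. chosen (\<omega> 0) (\<omega> 1) k}
        \<le> c k * (real d / 2 * x k * (1 - (if part k = heavy then ?g else 0)))"
      using prob_chosen_le[of k] prob_chosen_heavy_le[of k] c_nonneg[of k]
      by (intro mult_left_mono) auto
    also have "\<dots> = real d / 2 * (c k * x k) - real d / 2 * ?g * (if part k = heavy then c k * x k else 0)"
      by (cases "part k = heavy") (simp_all add: right_diff_distrib mult_ac)
    finally show "c k * tape_prob.prob {\<omega>\<in>space tape. chosen (\<omega> 0) (\<omega> 1) k} \<le> \<dots>" .
  qed
  also have "\<dots> = real d / 2 * ?W - real d / 2 * (?g * weight heavy)"
    unfolding weight_def by (simp add: sum_subtractf sum_distrib_left mult.assoc)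
  also have "\<dots> \<le> real d / 2 * ?W - real d / 2 * (?W / (32 * real n))"
  proof -
    \<comment> \<open>This is \<open>heavy_gain\<close> divided by
      \<open>32 * n * (size_of light + 1)\<close>; the factor \<open>d / 2\<close> later turns 32
      into 64. For \<open>n = 0\<close> the left side is 0 by division by zero.\<close>
    have "?W / (32 * real n) \<le> ?g * weight heavy"
    proof (cases "n = 0")
      case True
      then show ?thesis using size_of_bounds(1)[of light] weight_nonneg[of heavy] by simp
    next
      case False
      have "0 < size_of light + 1" using size_of_bounds(1)[of light] by simp
      with False heavy_gain show ?thesis by (simp add: field_simps)
    qed
    then show ?thesis by (intro diff_left_mono mult_left_mono) auto
  qed
  also have "\<dots> = (real d / 2 - real d / (64 * real n)) * ?W"
    by (simp add: algebra_simps)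
  finally show ?thesis .
qed

end

section \<open>Transfer from indices to vertices\<close>

lemma final_mem_eq: "exec \<omega> p s t s' \<Longrightarrow> final_mem \<omega> p s = s'"
  unfolding final_mem_def using exec_deterministic by (intro the_equality) blast+

lemma rounding_com_correct:
  fixes V :: "'a set"
  assumes d: "4 \<le> d" and B: "hypergraph V B" and Vs: "d_partition d V B Vs"
    and c: "\<forall>v\<in>V. c v \<ge> 0" and x: "fractional_vertex_cover V B x"
    and e: "bij_betw e {..<card V} V"
  defines "y \<equiv> computed_vector rounding_com d V Vs c x e"
  shows "\<omega> \<in> space tape \<Longrightarrow>
      halts_within (100 * (card V + d)) \<omega> rounding_com (input_mem d V Vs c x e)"
    and "\<omega> \<in> space tape \<Longrightarrow> integral_vertex_cover V B (y \<omega>)"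
    and "v \<in> V \<Longrightarrow> (\<lambda>\<omega>. y \<omega> v) \<in> borel_measurable tape"
    and "(\<integral>\<omega>. (\<Sum>v\<in>V. c v * y \<omega> v) \<partial>tape)
      \<le> (real d / 2 - real d / (64 * real (card V))) * (\<Sum>v\<in>V. c v * x v)"
proof -
  let ?n = "card V" and ?s = "input_mem d V Vs c x e"
  \<comment> \<open>The extensions by 0 agree with \<open>input_mem\<close>, so that
    \<open>loaded\<close> holds as an equality of whole arrays.\<close>
  define part where "part k = (if k < ?n then THE i. i \<in> {1..d} \<and> e k \<in> Vs i else 0)" for k
  define c' where "c' k = (if k < ?n then c (e k) else 0)" for k
  define x' where "x' k = (if k < ?n then x (e k) else 0)" for k
  have e_V: "e k \<in> V" if "k < ?n" for k
    using e that by (auto simp: bij_betw_def)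
  have e_inj: "inj_on e {..<?n}" and e_image: "e ` {..<?n} = V"
    using e by (auto simp: bij_betw_def)
  have e_surj: "\<exists>k<?n. v = e k" if "v \<in> V" for v
  proof -
    from that have "v \<in> e ` {..<?n}" by (simp only: e_image)
    then show ?thesis by auto
  qed
  have part: "part k \<in> {1..d} \<and> e k \<in> Vs (part k)" if k: "k < ?n" for k
  proof -
    obtain i where i: "i \<in> {1..d}" "e k \<in> Vs i"
      using e_V[OF k] Vs by (auto simp: d_partition_def)
    moreover have "j = i" if "j \<in> {1..d} \<and> e k \<in> Vs j" for j
      using that i Vs unfolding d_partition_def disjoint_family_on_def by blast
    ultimately have "\<exists>!i. i \<in> {1..d} \<and> e k \<in> Vs i" by blast
    from theI'[OF this] k show ?thesis by (simp add: part_def)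
  qed
  interpret R: rounding_instance ?n d part c' x'
    using d part c x e_V
    by unfold_locales (auto simp: c'_def x'_def fractional_vertex_cover_def)

  have run: "reaches \<omega> rounding_com ?s (100 * (?n + d))
      (\<lambda>s. \<forall>k<?n. narr s ''out'' k = of_bool (R.chosen (\<omega> 0) (\<omega> 1) k))" for \<omega>
    by (rule R.reaches_rounding)
       (auto simp: R.loaded_def input_mem_def part_def c'_def x'_def fun_eq_iff)
  have y: "y \<omega> (e k) = of_bool (R.chosen (\<omega> 0) (\<omega> 1) k)" if "k < ?n" for \<omega> k
  proof -
    obtain t s' where s': "exec \<omega> rounding_com ?s t s'"
        "\<forall>k<?n. narr s' ''out'' k = of_bool (R.chosen (\<omega> 0) (\<omega> 1) k)"
      using run[of \<omega>] unfolding reaches_def by blast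
    show ?thesis
      using that s'(2) the_inv_into_f_f[OF e_inj, of k]
      by (simp add: y_def computed_vector_def output_vector_def final_mem_eq[OF s'(1)])
  qed
  have y_01: "y \<omega> v \<in> {0, 1}" if "v \<in> V" for \<omega> v
  proof -
    from e_surj[OF that] obtain k where "k < ?n" "v = e k" by blast
    then show ?thesis using y by simp
  qed

  show "halts_within (100 * (card V + d)) \<omega> rounding_com ?s"
    using run[of \<omega>] unfolding reaches_def halts_within_def by blast

  show "integral_vertex_cover V B (y \<omega>)" if \<omega>: "\<omega> \<in> space tape"
    unfolding integral_vertex_cover_def
  proof (intro conjI ballI)
    fix P assume P: "P \<in> B"
    then have "P \<subseteq> V" "finite P"
      using B finite_subset by (auto simp: hypergraph_def)
    define I where "I = {k. k < ?n \<and> e k \<in> P}"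
    have I: "I \<subseteq> {..<?n}" by (auto simp: I_def)
    \<comment> \<open>A hyperedge meets each part at most once, so its index set is a
      transversal.\<close>
    have "inj_on part I"
    proof (rule inj_onI)
      fix k l assume kl: "k \<in> I" "l \<in> I" "part k = part l"
      then have "e k \<in> P \<inter> Vs (part k)" "e l \<in> P \<inter> Vs (part k)"
        using part[of k] part[of l] by (auto simp: I_def)
      moreover have "card (P \<inter> Vs (part k)) \<le> Suc 0"
        using Vs P part[of k] kl(1) by (auto simp: d_partition_def I_def)
      ultimately have "e k = e l"
        using \<open>finite P\<close> card_le_Suc0_iff_eq[of "P \<inter> Vs (part k)"] by blast
      then show "k = l" using e_inj kl by (auto simp: I_def inj_on_def)
    qed
    have "e ` I = P"
    proof
      show "P \<subseteq> e ` I"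
      proof
        fix v assume "v \<in> P"
        then obtain k where "k < ?n" "v = e k" using \<open>P \<subseteq> V\<close> e_surj by (meson subsetD)
        with \<open>v \<in> P\<close> show "v \<in> e ` I" by (simp add: I_def)
      qed
    qed (auto simp: I_def)
    then have "(\<Sum>v\<in>P. x v) = (\<Sum>k\<in>I. x (e k))"
      using sum.reindex[OF inj_on_subset[OF e_inj I], of x] by simp
    also have "\<dots> = (\<Sum>k\<in>I. x' k)"
      by (intro sum.cong) (auto simp: x'_def I_def)
    finally have "1 \<le> (\<Sum>k\<in>I. x' k)"
      using x P by (auto simp: fractional_vertex_cover_def)
    then obtain k where k: "k \<in> I" "R.chosen (\<omega> 0) (\<omega> 1) k"
      using R.transversal_chosen[OF _ _ I \<open>inj_on part I\<close>, of "\<omega> 0" "\<omega> 1"] \<omega>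
      unfolding space_tape by blast
    have "y \<omega> (e k) \<le> (\<Sum>v\<in>P. y \<omega> v)"
      using k(1) \<open>finite P\<close> \<open>P \<subseteq> V\<close> y_01[of _ \<omega>]
      by (intro member_le_sum) (force simp: I_def)+
    then show "1 \<le> (\<Sum>v\<in>P. y \<omega> v)"
      using k y[of k \<omega>] by (simp add: I_def)
  qed (rule y_01)

  show "(\<lambda>\<omega>. y \<omega> v) \<in> borel_measurable tape" if "v \<in> V" for v
  proof -
    from e_surj[OF that] obtain k where k: "k < ?n" "v = e k" by blast
    show ?thesis unfolding k(2) y[OF k(1)] using R.measurable_chosen by measurable
  qed

  have sum_V: "(\<Sum>v\<in>V. f v) = (\<Sum>k<?n. f (e k))" for f :: "'a \<Rightarrow> real"
    using sum.reindex[OF e_inj, of f] by (simp add: e_image)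
  define A where "A k = {\<omega>\<in>space tape. R.chosen (\<omega> 0) (\<omega> 1) k}" for k
  have A: "A k \<in> sets tape" for k
    unfolding A_def using R.measurable_chosen by measurable
  have A_space: "A k \<inter> space tape = A k" for k
    by (auto simp: A_def)
  \<comment> \<open>The cost is a finite combination of indicators, so linearity reduces the
    expectation to selection probabilities.\<close>
  have "(\<integral>\<omega>. (\<Sum>v\<in>V. c v * y \<omega> v) \<partial>tape) = (\<integral>\<omega>. (\<Sum>k<?n. c' k * indicator (A k) \<omega>) \<partial>tape)"
    unfolding sum_V by (intro Bochner_Integration.integral_cong refl sum.cong)
      (auto simp: y c'_def A_def indicator_def)
  also have "\<dots> = (\<Sum>k<?n. c' k * tape_prob.prob (A k))"
    using A by (subst Bochner_Integration.integral_sum)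
      (auto simp: A_space tape_prob.emeasure_eq_measure)
  also have "\<dots> \<le> (real d / 2 - real d / (64 * real ?n)) * (\<Sum>k<?n. c' k * x' k)"
    unfolding A_def by (rule R.expected_cost)
  also have "(\<Sum>k<?n. c' k * x' k) = (\<Sum>v\<in>V. c v * x v)"
    unfolding sum_V by (intro sum.cong) (auto simp: c'_def x'_def)
  finally show "(\<integral>\<omega>. (\<Sum>v\<in>V. c v * y \<omega> v) \<partial>tape)
      \<le> (real d / 2 - real d / (64 * real ?n)) * (\<Sum>v\<in>V. c v * x v)" .
qed

theorem theorem13:
  "\<exists>(prog :: com) (K :: nat).
     \<forall>(d :: nat) (V :: 'a set) (B :: 'a set set) (Vs :: nat \<Rightarrow> 'a set)
       (c :: 'a \<Rightarrow> real) (x :: 'a \<Rightarrow> real) (e :: nat \<Rightarrow> 'a).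
       d \<ge> 4 \<and> hypergraph V B \<and> d_partition d V B Vs \<and> (\<forall>v\<in>V. c v \<ge> 0) \<and>
       fractional_vertex_cover V B x \<and> bij_betw e {..<card V} V \<longrightarrow>
       (\<forall>\<omega>\<in>space tape.
          halts_within (K * (card V + d)) \<omega> prog (input_mem d V Vs c x e) \<and>
          integral_vertex_cover V B (computed_vector prog d V Vs c x e \<omega>)) \<and>
       (\<forall>v\<in>V. (\<lambda>\<omega>. computed_vector prog d V Vs c x e \<omega> v) \<in> borel_measurable tape) \<and>
       (\<integral>\<omega>. (\<Sum>v\<in>V. c v * computed_vector prog d V Vs c x e \<omega> v) \<partial>tape)
         \<le> (real d / 2 - real d / (64 * real (card V))) * (\<Sum>v\<in>V. c v * x v)"
proof (intro exI[of _ rounding_com] exI[of _ 100] allI impI, elim conjE)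
  fix d V B Vs and c x :: "'a \<Rightarrow> real" and e :: "nat \<Rightarrow> 'a"
  assume "4 \<le> d" "hypergraph V B" "d_partition d V B Vs" "\<forall>v\<in>V. c v \<ge> 0"
    "fractional_vertex_cover V B x" "bij_betw e {..<card V} V"
  note correct = rounding_com_correct[OF this]
  show "(\<forall>\<omega>\<in>space tape.
          halts_within (100 * (card V + d)) \<omega> rounding_com (input_mem d V Vs c x e) \<and>
          integral_vertex_cover V B (computed_vector rounding_com d V Vs c x e \<omega>)) \<and>
       (\<forall>v\<in>V. (\<lambda>\<omega>. computed_vector rounding_com d V Vs c x e \<omega> v) \<in> borel_measurable tape) \<and>
       (\<integral>\<omega>. (\<Sum>v\<in>V. c v * computed_vector rounding_com d V Vs c x e \<omega> v) \<partial>tape)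
         \<le> (real d / 2 - real d / (64 * real (card V))) * (\<Sum>v\<in>V. c v * x v)"
    using correct by simp
qed

end
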